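(* Let $\{T(t)\}_{t\ge0}$ be a $C_0$-semigroup on a complex Banach space generated by a scalar type spectral operator $A$. Then $$\sigma(T(t))=\overline{e^{t\sigma(A)}},\qquad t\ge0.$$
   Context: Spectrum: for a closed linear operator $B$ in a complex Banach space $X$, the resolvent set $\rho(B)$ is the set of $\lambda\in\mathbb{C}$ for which $(B-\lambda I)^{-1}$ exists as a bounded linear operator on all of $X$, and $\sigma(B)=\mathbb{C}\setminus\rho(B)$. Scalar type spectral operator (Dunford, Bade): a densely defined closed linear operator $A$ in $X$ for which there is a (necessarily unique) strongly $\sigma$-additive spectral measure $E_A$ (the resolution of the identity), i.e. a map from the Borel sets of $\mathbb{C}$ to bounded projections on $X$ with $E_A(\emptyset)=0$, $E_A(\mathbb{C})=I$, $E_A(\delta_1\cap\delta_2)=E_A(\delta_1)E_A(\delta_2)$, and $\sigma$-additive in the strong operator topology, such that $A=\int_{\mathbb{C}}\lambda\,dE_A(\lambda)$; that is, the domain of $A$ consists of all $f\in X$ for which $\lim_{n\to\infty}\left(\int_{\{|\lambda|\le n\}}\lambda\,dE_A(\lambda)\right)f$ exists, and $Af$ is this limit (the integral of a bounded Borel function being the operator-norm limit of the integrals of uniformly approximating simple functions). The spectrum $\sigma(A)$ is the support of $E_A$. When such an $A$ generates a $C_0$-semigroup, all the operators $T(t)$ are themselves scalar type spectral. Notation: $e^{tS}=\{e^{t\lambda}:\lambda\in S\}$ for $S\subseteq\mathbb{C}$; the bar denotes closure in $\mathbb{C}$. *)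

theory Defs
  imports "HOL-Analysis.Analysis"
begin

section \<open>Complex Banach spaces\<close>

text \<open>The norm, metric and topology are those of the underlying real Banach space;
  the complex scalar multiplication extends the real one.\<close>

class complex_normed_vector = real_normed_vector +
  fixes scaleC :: "complex \<Rightarrow> 'a \<Rightarrow> 'a"  (infixr "*\<^sub>C" 75)
  assumes scaleC_add_right: "a *\<^sub>C (x + y) = a *\<^sub>C x + a *\<^sub>C y"
    and scaleC_add_left: "(a + b) *\<^sub>C x = a *\<^sub>C x + b *\<^sub>C x"
    and scaleC_scaleC: "a *\<^sub>C (b *\<^sub>C x) = (a * b) *\<^sub>C x"
    and scaleR_scaleC: "r *\<^sub>R x = complex_of_real r *\<^sub>C x"
    and norm_scaleC: "norm (a *\<^sub>C x) = cmod a * norm x"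

class cbanach = complex_normed_vector + banach

instantiation complex :: cbanach
begin

definition scaleC_complex :: "complex \<Rightarrow> complex \<Rightarrow> complex"
  where "scaleC_complex a x = a * x"

instance
  by standard (simp_all add: scaleC_complex_def algebra_simps scaleR_conv_of_real norm_mult)

end


section \<open>Linear operators\<close>

definition bounded_clinear :: "('a::complex_normed_vector \<Rightarrow> 'a) \<Rightarrow> bool"
  where "bounded_clinear S \<longleftrightarrow>
    bounded_linear S \<and> (\<forall>c f. S (c *\<^sub>C f) = c *\<^sub>C S f)"

text \<open>An unbounded operator is given by its domain \<open>D\<close> and a function \<open>A\<close> of which only the
  values on \<open>D\<close> matter. A bounded operator on the whole space has domain \<open>UNIV\<close>.\<close>

definition linear_operator :: "'a::complex_normed_vector set \<Rightarrow> ('a \<Rightarrow> 'a) \<Rightarrow> bool"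
  where "linear_operator D A \<longleftrightarrow>
    0 \<in> D \<and>
    (\<forall>f\<in>D. \<forall>g\<in>D. f + g \<in> D \<and> A (f + g) = A f + A g) \<and>
    (\<forall>c. \<forall>f\<in>D. c *\<^sub>C f \<in> D \<and> A (c *\<^sub>C f) = c *\<^sub>C A f)"

definition closed_operator :: "'a::complex_normed_vector set \<Rightarrow> ('a \<Rightarrow> 'a) \<Rightarrow> bool"
  where "closed_operator D A \<longleftrightarrow> closed ((\<lambda>f. (f, A f)) ` D)"

definition resolvent_set :: "'a::complex_normed_vector set \<Rightarrow> ('a \<Rightarrow> 'a) \<Rightarrow> complex set"
  where "resolvent_set D B = {z. \<exists>R. bounded_clinear R \<and>
    (\<forall>g. R g \<in> D \<and> B (R g) - z *\<^sub>C R g = g) \<and>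
    (\<forall>f\<in>D. R (B f - z *\<^sub>C f) = f)}"

definition spectrum :: "'a::complex_normed_vector set \<Rightarrow> ('a \<Rightarrow> 'a) \<Rightarrow> complex set"
  where "spectrum D B = - resolvent_set D B"


section \<open>Semigroups\<close>

definition C0_semigroup :: "(real \<Rightarrow> 'a::complex_normed_vector \<Rightarrow> 'a) \<Rightarrow> bool"
  where "C0_semigroup T \<longleftrightarrow>
    (\<forall>t\<ge>0. bounded_clinear (T t)) \<and>
    T 0 = id \<and>
    (\<forall>s\<ge>0. \<forall>t\<ge>0. T (s + t) = T s \<circ> T t) \<and>
    (\<forall>f. ((\<lambda>t. T t f) \<longlongrightarrow> f) (at_right 0))"

definition has_generator ::
    "(real \<Rightarrow> 'a::complex_normed_vector \<Rightarrow> 'a) \<Rightarrow> 'a set \<Rightarrow> ('a \<Rightarrow> 'a) \<Rightarrow> bool"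
  where "has_generator T D A \<longleftrightarrow>
    D = {f. \<exists>g. ((\<lambda>h. (T h f - f) /\<^sub>R h) \<longlongrightarrow> g) (at_right 0)} \<and>
    (\<forall>f\<in>D. ((\<lambda>h. (T h f - f) /\<^sub>R h) \<longlongrightarrow> A f) (at_right 0))"


section \<open>Scalar type spectral operators\<close>

text \<open>Only the values of \<open>E\<close> on Borel sets matter.\<close>

definition spectral_measure ::
    "(complex set \<Rightarrow> 'a::complex_normed_vector \<Rightarrow> 'a) \<Rightarrow> bool"
  where "spectral_measure E \<longleftrightarrow>
    (\<forall>\<delta>\<in>sets borel. bounded_clinear (E \<delta>) \<and> E \<delta> \<circ> E \<delta> = E \<delta>) \<and>
    E {} = (\<lambda>f. 0) \<and>
    E UNIV = id \<and>
    (\<forall>\<delta>\<in>sets borel. \<forall>\<epsilon>\<in>sets borel. E (\<delta> \<inter> \<epsilon>) = E \<delta> \<circ> E \<epsilon>) \<and>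
    (\<forall>\<delta> :: nat \<Rightarrow> complex set. range \<delta> \<subseteq> sets borel \<longrightarrow> disjoint_family \<delta> \<longrightarrow>
      (\<forall>f. (\<lambda>n. E (\<delta> n) f) sums E (\<Union>n. \<delta> n) f))"

definition simple_spectral_integral ::
    "(complex set \<Rightarrow> 'a::complex_normed_vector \<Rightarrow> 'a) \<Rightarrow> (complex \<Rightarrow> complex) \<Rightarrow> 'a \<Rightarrow> 'a"
  where "simple_spectral_integral E s f = (\<Sum>c\<in>range s. c *\<^sub>C E (s -` {c}) f)"

text \<open>For a bounded Borel function \<open>F\<close> the integral is the limit in operator norm of the
  integrals of simple Borel functions converging uniformly to \<open>F\<close>. For a spectral measure \<open>E\<close>
  on a Banach space it exists and does not depend on the approximating sequence, since the
  values of \<open>E\<close> are uniformly bounded.\<close>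

definition has_spectral_integral ::
    "(complex set \<Rightarrow> 'a::complex_normed_vector \<Rightarrow> 'a) \<Rightarrow> (complex \<Rightarrow> complex) \<Rightarrow> ('a \<Rightarrow> 'a) \<Rightarrow> bool"
  where "has_spectral_integral E F S \<longleftrightarrow> bounded_clinear S \<and>
    (\<exists>s :: nat \<Rightarrow> complex \<Rightarrow> complex.
      (\<forall>n. simple_function borel (s n)) \<and>
      uniform_limit UNIV s F sequentially \<and>
      (\<lambda>n. onorm (\<lambda>f. simple_spectral_integral E (s n) f - S f)) \<longlonglongrightarrow> 0)"

definition spectral_integral ::
    "(complex set \<Rightarrow> 'a::complex_normed_vector \<Rightarrow> 'a) \<Rightarrow> (complex \<Rightarrow> complex) \<Rightarrow> 'a \<Rightarrow> 'a"
  where "spectral_integral E F = (THE S. has_spectral_integral E F S)"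

definition truncated_integral ::
    "(complex set \<Rightarrow> 'a::complex_normed_vector \<Rightarrow> 'a) \<Rightarrow> nat \<Rightarrow> 'a \<Rightarrow> 'a"
  where "truncated_integral E n =
    spectral_integral E (\<lambda>z. if cmod z \<le> real n then z else 0)"

definition resolution_of_identity ::
    "(complex set \<Rightarrow> 'a::complex_normed_vector \<Rightarrow> 'a) \<Rightarrow> 'a set \<Rightarrow> ('a \<Rightarrow> 'a) \<Rightarrow> bool"
  where "resolution_of_identity E D A \<longleftrightarrow>
    spectral_measure E \<and>
    D = {f. convergent (\<lambda>n. truncated_integral E n f)} \<and>
    (\<forall>f\<in>D. (\<lambda>n. truncated_integral E n f) \<longlonglongrightarrow> A f)"

definition scalar_type_spectral :: "'a::complex_normed_vector set \<Rightarrow> ('a \<Rightarrow> 'a) \<Rightarrow> bool"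
  where "scalar_type_spectral D A \<longleftrightarrow>
    linear_operator D A \<and> closure D = UNIV \<and> closed_operator D A \<and>
    (\<exists>E. resolution_of_identity E D A)"

end

theory Submission
  imports Defs
begin

text \<open>
  The resolution of the identity \<open>E\<close> gives a bounded multiplicative calculus \<open>F \<mapsto> Phi F\<close> on bounded Borel
  functions. On the range of each projection \<open>E (cball 0 n)\<close> the generator is bounded, so there \<open>T t\<close>
  must be \<open>Phi\<close> of the cut-off exponential. Hence both \<open>A\<close> and \<open>T t\<close> are spectral integrals, of \<open>z\<close>
  and of \<open>exp (t * z)\<close>. The spectrum of the spectral integral of \<open>F\<close> is the essential range of
  \<open>F\<close>, the set of \<open>\<mu>\<close> such that \<open>E (F -` ball \<mu> r) \<noteq> 0\<close> for all \<open>r > 0\<close>. In particular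
  \<open>\<sigma>(A)\<close> is the support of \<open>E\<close>, and by continuity the essential range of the exponential is
  the closure of its image on that support.
\<close>

section \<open>Uniform boundedness, convexity and right derivatives\<close>

text \<open>Nothing in the hypotheses ties \<open>T t\<close> to the projections directly:
  \<open>T\<close> meets \<open>A\<close> through a right derivative, and \<open>A\<close> meets
  \<open>E\<close> through a limit of truncated integrals. So commutation of \<open>T t\<close> with
  \<open>E\<close> has to be derived, and only one-sided derivatives are at hand.

  For \<open>t > 0\<close> the function \<open>exp (t * z)\<close> is unbounded on the plane and
  cannot be put into \<open>Phi\<close>. It is therefore treated like the unbounded function
  \<open>z\<close>, known only through its cut-offs to balls. One lemma about closed operators then
  yields the spectrum of \<open>A\<close> and of \<open>T t\<close> alike.

  The projections need not be contractions, so the norm of \<open>Phi F\<close> is controlled by the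
  supremum of \<open>F\<close> only up to a constant. This suffices: where the constant enters the
  spectral argument, the radius \<open>r\<close> can be shrunk to absorb it.\<close>

lemma uniform_boundedness:
  fixes S :: "'i \<Rightarrow> 'a::banach \<Rightarrow> 'b::real_normed_vector"
  assumes lin: "\<And>i. i \<in> I \<Longrightarrow> bounded_linear (S i)"
    and ptw: "\<And>x. \<exists>K. \<forall>i\<in>I. norm (S i x) \<le> K"
  shows "\<exists>M\<ge>0. \<forall>i\<in>I. \<forall>x. norm (S i x) \<le> M * norm x"
proof -
  define C where "C n = {x. \<forall>i\<in>I. norm (S i x) \<le> real n}" for n
  have closed: "closed (C n)" for n
  proof -
    have "C n = (\<Inter>i\<in>I. {x. norm (S i x) \<le> real n})"
      by (auto simp: C_def)
    moreover have "closed {x. norm (S i x) \<le> real n}" if "i \<in> I" for i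
      using lin[OF that]
      by (intro closed_Collect_le continuous_intros linear_continuous_on bounded_linear.continuous_on)
        auto
    ultimately show ?thesis by auto
  qed
  have "(\<Union>n. C n) = UNIV"
  proof (intro set_eqI iffI UNIV_I)
    fix x
    obtain K where K: "\<forall>i\<in>I. norm (S i x) \<le> K" using ptw by blast
    obtain n :: nat where "K \<le> real n" using real_arch_simple by blast
    then show "x \<in> (\<Union>n. C n)" using K by (auto simp: C_def intro: order_trans)
  qed
  then have "\<exists>n. interior (C n) \<noteq> {}"
    using Baire_category_alt[of "euclidean :: 'a topology" "range C"] closed
      completely_metrizable_space_euclidean
    by (fastforce simp: euclidean_interior_of)
  then obtain n x e where e: "e > 0" "cball x e \<subseteq> C n"
    by (metis ex_in_conv mem_interior_cball)
  have bound: "norm (S i y) \<le> (2 * n / e) * norm y" if i: "i \<in> I" for i y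
  proof (cases "y = 0")
    case True
    interpret bounded_linear "S i" by (rule lin[OF i])
    show ?thesis using True by (simp add: zero)
  next
    case False
    interpret bounded_linear "S i" by (rule lin[OF i])
    \<comment> \<open>Rescaling \<open>y\<close> to norm \<open>e\<close> keeps \<open>x + z\<close>
      in the ball; writing \<open>z\<close> as a difference of two points of \<open>C n\<close>
      costs the factor 2.\<close>
    define z where "z = (e / norm y) *\<^sub>R y"
    have "x + z \<in> C n" "x \<in> C n" using e False by (auto simp: z_def dist_norm intro!: subsetD[OF e(2)])
    then have "norm (S i (x + z)) \<le> n" "norm (S i x) \<le> n" using i by (auto simp: C_def)
    then have "norm (S i z) \<le> 2 * n"
      using norm_triangle_ineq4[of "S i (x + z)" "S i x"] by (simp add: add)
    then show ?thesis using e False by (simp add: z_def scaleR field_simps)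
  qed
  show ?thesis
    by (rule exI[of _ "2 * n / e"]) (use bound e in auto)
qed

text \<open>A convex function on the cube takes its maximum at a vertex.\<close>

lemma norm_cube_sum_le:
  fixes x :: "'i \<Rightarrow> 'b::real_normed_vector"
  assumes "finite I" "\<And>i. i \<in> I \<Longrightarrow> 0 \<le> c i \<and> c i \<le> 1"
    and "\<And>J. J \<subseteq> I \<Longrightarrow> norm (v + sum x J) \<le> M"
  shows "norm (v + (\<Sum>i\<in>I. c i *\<^sub>R x i)) \<le> M"
  using assms
proof (induction I arbitrary: v rule: finite_induct)
  case empty
  from empty(2)[of "{}"] show ?case by simp
next
  case (insert j I)
  let ?s = "\<Sum>i\<in>I. c i *\<^sub>R x i"
  have c: "0 \<le> c j" "c j \<le> 1" using insert.prems(1) by auto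
  have "norm (v + ?s) \<le> M"
    by (rule insert.IH) (use insert.prems in auto)
  moreover have "norm (v + x j + ?s) \<le> M"
  proof (rule insert.IH)
    fix J assume J: "J \<subseteq> I"
    then have "finite J" "j \<notin> J" using insert.hyps finite_subset by auto
    then show "norm (v + x j + sum x J) \<le> M"
      using insert.prems(2)[of "insert j J"] J by (auto simp: add.assoc)
  qed (use insert.prems in auto)
  ultimately have "norm ((1 - c j) *\<^sub>R (v + ?s) + c j *\<^sub>R (v + x j + ?s)) \<le> (1 - c j) * M + c j * M"
    using c by (intro norm_triangle_le add_mono) (auto intro: mult_left_mono)
  moreover have "(1 - c j) *\<^sub>R (v + ?s) + c j *\<^sub>R (v + x j + ?s) = v + (c j *\<^sub>R x j + ?s)"
    by (simp add: algebra_simps)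
  ultimately show ?case using insert.hyps by (simp add: algebra_simps)
qed

text \<open>Semigroups provide right derivatives only, so the mean value theorem is replaced by a
  last-point argument: the times \<open>s\<close> with \<open>norm (w s - w 0) \<le> e * s\<close>
  form a compact set, and the right derivative at its maximum would push past it unless the maximum
  is \<open>t\<close>. Then \<open>e\<close> tends to 0.\<close>

lemma constant_if_right_derivative_zero:
  fixes w :: "real \<Rightarrow> 'b::real_normed_vector"
  assumes cont: "continuous_on {0..t} w" and t: "0 \<le> t"
    and der: "\<And>s. 0 \<le> s \<Longrightarrow> s < t \<Longrightarrow> ((\<lambda>h. (w (s + h) - w s) /\<^sub>R h) \<longlongrightarrow> 0) (at_right 0)"
  shows "w t = w 0"
proof -
  have le: "norm (w t - w 0) \<le> e * t" if e: "e > 0" for e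
  proof -
    define S where "S = {s\<in>{0..t}. norm (w s - w 0) \<le> e * s}"
    have "closed S" unfolding S_def
      by (intro continuous_on_closed_Collect_le continuous_intros cont)
    then have "compact S"
      using compact_Int_closed[of "{0..t}" S] by (simp add: S_def Int_def conj_commute cong: conj_cong)
    moreover have "S \<noteq> {}" using t by (force simp: S_def)
    ultimately obtain c where c: "c \<in> S" "\<And>s. s \<in> S \<Longrightarrow> s \<le> c"
      using compact_attains_sup by metis
    have "c = t"
    proof (rule ccontr)
      assume "c \<noteq> t"
      then have "0 \<le> c" "c < t" using c(1) by (auto simp: S_def)
      from tendstoD[OF der[OF this] e]
      have "\<forall>\<^sub>F h in at_right 0. norm ((w (c + h) - w c) /\<^sub>R h) < e" by (simp add: dist_norm)
      moreover have "\<forall>\<^sub>F h in at_right 0. 0 < h \<and> h < t - c"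
        using \<open>c < t\<close> by (simp add: eventually_at_right_field) (meson diff_gt_0_iff_gt)
      ultimately obtain h where h: "0 < h" "h < t - c" "norm ((w (c + h) - w c) /\<^sub>R h) < e"
        using eventually_happens'[OF _ eventually_conj] by (metis (no_types, lifting) trivial_limit_at_right_real)
      then have "norm (w (c + h) - w c) \<le> e * h"
        by (simp add: divide_inverse_commute[symmetric] pos_divide_less_eq)
      moreover have "norm (w c - w 0) \<le> e * c" using c(1) by (simp add: S_def)
      ultimately have "norm (w (c + h) - w 0) \<le> e * (c + h)"
        using norm_triangle_ineq[of "w (c + h) - w c" "w c - w 0"] by (simp add: algebra_simps)
      then have "c + h \<in> S" using h \<open>0 \<le> c\<close> by (simp add: S_def)
      then show False using c(2) h by fastforce
    qed
    then show ?thesis using c(1) by (simp add: S_def)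
  qed
  have "((\<lambda>e. e * t) \<longlongrightarrow> 0 * t) (at_right 0)"
    by (intro tendsto_intros)
  moreover have "\<forall>\<^sub>F e in at_right 0. norm (w t - w 0) \<le> e * t"
    using le by (auto simp: eventually_at_right_field intro: exI[of _ 1])
  ultimately have "norm (w t - w 0) \<le> 0 * t"
    by (rule tendsto_lowerbound) simp
  then show ?thesis by simp
qed

section \<open>Spectral measures and integrals of simple functions\<close>

lemma scaleC_zero_left [simp]: "0 *\<^sub>C x = 0"
  using norm_scaleC[of 0 x] by simp

lemma scaleC_zero_right [simp]: "c *\<^sub>C 0 = 0"
  using norm_scaleC[of c 0] by simp

lemma scaleC_one [simp]: "1 *\<^sub>C x = x"
  using scaleR_scaleC[of 1 x] by simp

lemma scaleC_minus_one: "(-1) *\<^sub>C x = - x"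
  using scaleR_scaleC[of "-1" x] by simp

lemma bounded_linear_scaleC: "bounded_linear (\<lambda>x. c *\<^sub>C x)"
  by (rule bounded_linear_intro[where K = "cmod c"])
    (simp_all add: scaleC_add_right norm_scaleC scaleR_scaleC scaleC_scaleC mult.commute)

lemma scaleC_sum_right: "c *\<^sub>C (\<Sum>i\<in>I. x i) = (\<Sum>i\<in>I. c *\<^sub>C x i)"
  by (rule linear_sum[OF bounded_linear.linear[OF bounded_linear_scaleC]])

text \<open>Reduces complex coefficients to real ones, to which the convexity argument on the cube
  applies.\<close>

lemma scaleC_complex_split: "c *\<^sub>C x = Re c *\<^sub>R x + \<i> *\<^sub>C (Im c *\<^sub>R x)"
proof -
  have "c *\<^sub>C x = (complex_of_real (Re c) + \<i> * complex_of_real (Im c)) *\<^sub>C x"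
    using complex_eq[of c] by simp
  then show ?thesis by (simp only: scaleC_add_left scaleR_scaleC scaleC_scaleC)
qed

section \<open>Additivity and boundedness of the spectral measure\<close>

locale spectral_measure_space =
  fixes E :: "complex set \<Rightarrow> 'a::cbanach \<Rightarrow> 'a"
  assumes spectral_measure: "spectral_measure E"
begin

lemma bounded_linear_E: "\<delta> \<in> sets borel \<Longrightarrow> bounded_linear (E \<delta>)"
  and E_scaleC: "\<delta> \<in> sets borel \<Longrightarrow> E \<delta> (c *\<^sub>C f) = c *\<^sub>C E \<delta> f"
  and E_empty [simp]: "E {} f = 0"
  and E_UNIV [simp]: "E UNIV f = f"
  and E_Int: "\<delta> \<in> sets borel \<Longrightarrow> \<epsilon> \<in> sets borel \<Longrightarrow> E (\<delta> \<inter> \<epsilon>) f = E \<delta> (E \<epsilon> f)"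
  and E_sums: "range A \<subseteq> sets borel \<Longrightarrow> disjoint_family A \<Longrightarrow>
    (\<lambda>n::nat. E (A n) f) sums E (\<Union>n. A n) f"
  using spectral_measure unfolding spectral_measure_def bounded_clinear_def by auto

lemma E_zero [simp]: "\<delta> \<in> sets borel \<Longrightarrow> E \<delta> 0 = 0"
  by (simp add: bounded_linear.linear bounded_linear_E linear_0)

lemma E_Un:
  assumes "A \<in> sets borel" "B \<in> sets borel" "A \<inter> B = {}"
  shows "E (A \<union> B) f = E A f + E B f"
proof -
  have "(\<lambda>n. E (binaryset A B n) f) sums E (\<Union>n. binaryset A B n) f"
    using assms by (intro E_sums) (auto simp: range_binaryset_eq disjoint_family_on_def binaryset_def)
  moreover have "(\<lambda>n. E (binaryset A B n) f) sums (\<Sum>n\<in>{0,1}. E (binaryset A B n) f)"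
    by (rule sums_finite) (auto simp: binaryset_def)
  ultimately show ?thesis
    using sums_unique2 by (fastforce simp: UN_binaryset_eq binaryset_def)
qed

lemma E_finite_UN:
  assumes "finite I" "\<And>i. i \<in> I \<Longrightarrow> A i \<in> sets borel" "disjoint_family_on A I"
  shows "E (\<Union>i\<in>I. A i) f = (\<Sum>i\<in>I. E (A i) f)"
  using assms
proof (induction I rule: finite_induct)
  case (insert i I)
  have "A i \<inter> (\<Union>i\<in>I. A i) = {}"
    using insert.prems(2) insert.hyps by (auto simp: disjoint_family_on_def)
  moreover have "(\<Union>i\<in>I. A i) \<in> sets borel" using insert by auto
  ultimately have "E (A i \<union> (\<Union>i\<in>I. A i)) f = E (A i) f + E (\<Union>i\<in>I. A i) f"
    using insert.prems by (intro E_Un) auto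
  also have "E (\<Union>i\<in>I. A i) f = (\<Sum>i\<in>I. E (A i) f)"
    using insert by (intro insert.IH) (auto intro: disjoint_family_on_mono)
  finally show ?case using insert.hyps by simp
qed simp

lemma E_incseq:
  assumes "range A \<subseteq> sets borel" "incseq A"
  shows "(\<lambda>n. E (A n) f) \<longlonglongrightarrow> E (\<Union>n. A n) f"
proof -
  have sets: "disjointed A n \<in> sets borel" for n
    using assms(1) by (auto simp: disjointed_def intro!: sets.Diff sets.finite_UN)
  have "(\<lambda>n. E (disjointed A n) f) sums E (\<Union>n. disjointed A n) f"
    using sets by (intro E_sums) (auto simp: disjoint_family_disjointed)
  then have "(\<lambda>n. \<Sum>i<Suc n. E (disjointed A i) f) \<longlonglongrightarrow> E (\<Union>n. A n) f"
    unfolding UN_disjointed_eq sums_def by (rule LIMSEQ_Suc)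
  moreover have "(\<Sum>i<Suc n. E (disjointed A i) f) = E (A n) f" for n
  proof -
    have "(\<Sum>i<Suc n. E (disjointed A i) f) = E (\<Union>i<Suc n. disjointed A i) f"
      by (rule E_finite_UN[symmetric])
        (auto simp: sets intro: disjoint_family_on_mono[OF _ disjoint_family_disjointed])
    also have "(\<Union>i<Suc n. disjointed A i) = (\<Union>i<Suc n. A i)"
      using finite_UN_disjointed_eq[of A "Suc n"] by (simp add: atLeast0LessThan)
    also have "\<dots> = A n"
      using assms(2) by (force simp: incseq_def less_Suc_eq_le)
    finally show ?thesis .
  qed
  ultimately show ?thesis by simp
qed

lemma E_subset_null:
  assumes "A \<in> sets borel" "B \<in> sets borel" "A \<subseteq> B" "E B f = 0"
  shows "E A f = 0"
  using E_Int[OF assms(1,2), of f] assms by (simp add: Int_absorb2)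

text \<open>The sets may overlap; their disjoint refinements are null as subsets of null sets, and
  \<sigma>-additivity applies to those.\<close>

lemma E_UN_null:
  assumes "range A \<subseteq> sets borel" "\<And>n::nat. E (A n) f = 0"
  shows "E (\<Union>n. A n) f = 0"
proof -
  have sets: "disjointed A n \<in> sets borel" for n
    using assms(1) by (auto simp: disjointed_def intro!: sets.Diff sets.finite_UN)
  have "(\<lambda>n. E (disjointed A n) f) sums E (\<Union>n. disjointed A n) f"
    using sets by (intro E_sums) (auto simp: disjoint_family_disjointed)
  moreover have "E (disjointed A n) f = 0" for n
    by (rule E_subset_null[OF sets _ disjointed_subset assms(2)]) (use assms(1) in auto)
  ultimately show ?thesis
    by (simp add: UN_disjointed_eq sums_iff)
qed

text \<open>If the values of the vector measure were unbounded on the subsets of \<open>\<delta>\<close>, then \<open>\<delta>\<close> would split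
  into a piece with the same defect and a piece of measure at least 1 in norm; iterating, one gets
  disjoint pieces that contradict \<open>\<sigma>\<close>-additivity.\<close>

lemma E_pointwise_bounded: "\<exists>K. \<forall>\<delta>\<in>sets borel. norm (E \<delta> f) \<le> K"
proof (rule ccontr)
  define bad where "bad \<delta> \<longleftrightarrow> \<delta> \<in> sets borel \<and>
    (\<forall>K. \<exists>\<epsilon>\<in>sets borel. \<epsilon> \<subseteq> \<delta> \<and> norm (E \<epsilon> f) > K)" for \<delta>
  assume "\<not> ?thesis"
  then have "bad UNIV" by (auto simp: bad_def not_le)
  have split: "\<exists>\<delta>'. bad \<delta>' \<and> \<delta>' \<subseteq> \<delta> \<and> 1 \<le> norm (E (\<delta> - \<delta>') f)" if \<delta>: "bad \<delta>" for \<delta>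
  proof -
    have [measurable]: "\<delta> \<in> sets borel" using \<delta> by (simp add: bad_def)
    \<comment> \<open>Exceeding \<open>norm (E \<delta> f)\<close> by more than 1 makes both
      \<epsilon> and its complement in \<delta> large, so it does not matter which of the two
      inherits the defect: the other one is the piece split off.\<close>
    obtain \<epsilon> where [measurable]: "\<epsilon> \<in> sets borel" and \<epsilon>: "\<epsilon> \<subseteq> \<delta>" "norm (E \<epsilon> f) > norm (E \<delta> f) + 1"
      using \<delta> unfolding bad_def by blast
    have "E \<delta> f = E \<epsilon> f + E (\<delta> - \<epsilon>) f"
      using E_Un[of \<epsilon> "\<delta> - \<epsilon>" f] \<epsilon>(1) by (simp add: Un_absorb1)
    moreover have "norm (E \<epsilon> f) \<ge> 1"
      using \<epsilon>(2) norm_ge_zero[of "E \<delta> f"] by linarith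
    ultimately have big: "1 \<le> norm (E (\<delta> - \<epsilon>) f)" "1 \<le> norm (E \<epsilon> f)"
      using \<epsilon>(2) norm_triangle_ineq4[of "E \<delta> f" "E (\<delta> - \<epsilon>) f"] by auto
    have bound: "\<exists>K. \<forall>\<gamma>\<in>sets borel. \<gamma> \<subseteq> \<beta> \<longrightarrow> norm (E \<gamma> f) \<le> K"
      if "\<not> bad \<beta>" "\<beta> \<in> sets borel" for \<beta>
      using that unfolding bad_def by (meson not_le)
    have "bad \<epsilon> \<or> bad (\<delta> - \<epsilon>)"
    proof (rule ccontr)
      assume "\<not> ?thesis"
      then have "\<not> bad \<epsilon>" "\<not> bad (\<delta> - \<epsilon>)" by blast+
      moreover have "\<epsilon> \<in> sets borel" "\<delta> - \<epsilon> \<in> sets borel" by measurable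
      ultimately obtain K L where
        KL: "\<And>\<gamma>. \<gamma> \<in> sets borel \<Longrightarrow> \<gamma> \<subseteq> \<epsilon> \<Longrightarrow> norm (E \<gamma> f) \<le> K"
          "\<And>\<gamma>. \<gamma> \<in> sets borel \<Longrightarrow> \<gamma> \<subseteq> \<delta> - \<epsilon> \<Longrightarrow> norm (E \<gamma> f) \<le> L"
        using bound by meson
      obtain \<gamma> where [measurable]: "\<gamma> \<in> sets borel" and \<gamma>: "\<gamma> \<subseteq> \<delta>" "norm (E \<gamma> f) > K + L"
        using \<delta> unfolding bad_def by blast
      have "\<gamma> = (\<gamma> \<inter> \<epsilon>) \<union> (\<gamma> - \<epsilon>)" by auto
      then have "E \<gamma> f = E (\<gamma> \<inter> \<epsilon>) f + E (\<gamma> - \<epsilon>) f"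
        using E_Un[of "\<gamma> \<inter> \<epsilon>" "\<gamma> - \<epsilon>" f] by auto
      moreover have "norm (E (\<gamma> \<inter> \<epsilon>) f) \<le> K" "norm (E (\<gamma> - \<epsilon>) f) \<le> L"
        using \<gamma>(1) by (auto intro!: KL)
      ultimately show False
        using \<gamma>(2) norm_triangle_ineq[of "E (\<gamma> \<inter> \<epsilon>) f" "E (\<gamma> - \<epsilon>) f"] by auto
    qed
    moreover have "\<delta> - (\<delta> - \<epsilon>) = \<epsilon>" using \<epsilon>(1) by auto
    ultimately show ?thesis using big \<epsilon>(1) by (metis Diff_subset)
  qed
  have "\<exists>d. \<forall>n::nat. bad (d n) \<and> d (Suc n) \<subseteq> d n \<and> 1 \<le> norm (E (d n - d (Suc n)) f)"
  proof (rule dependent_nat_choice[where P = "\<lambda>_. bad"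
        and Q = "\<lambda>_ \<delta> \<delta>'. \<delta>' \<subseteq> \<delta> \<and> 1 \<le> norm (E (\<delta> - \<delta>') f)"])
    show "\<exists>\<delta>. bad \<delta>" using \<open>bad UNIV\<close> by blast
    show "\<exists>\<delta>'. bad \<delta>' \<and> \<delta>' \<subseteq> \<delta> \<and> 1 \<le> norm (E (\<delta> - \<delta>') f)" if "bad \<delta>" for \<delta> and n :: nat
      by (rule split[OF that])
  qed
  then obtain d where d: "\<And>n. bad (d n)"
    "\<And>n::nat. d (Suc n) \<subseteq> d n \<and> 1 \<le> norm (E (d n - d (Suc n)) f)"
    by metis
  have anti: "d n \<subseteq> d m" if "m \<le> n" for m n
  proof -
    have "decseq d" by (rule decseq_SucI) (use d(2) in blast)
    then show ?thesis using that by (rule decseqD)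
  qed
  have "disjoint_family (\<lambda>n. d n - d (Suc n))"
    unfolding disjoint_family_on_def
  proof (intro ballI impI)
    fix m n :: nat assume "m \<noteq> n"
    then consider "Suc m \<le> n" | "Suc n \<le> m" by linarith
    then show "(d m - d (Suc m)) \<inter> (d n - d (Suc n)) = {}"
      using anti by cases blast+
  qed
  then have "(\<lambda>n. E (d n - d (Suc n)) f) sums E (\<Union>n. d n - d (Suc n)) f"
    using d(1) by (intro E_sums) (auto simp: bad_def)
  then have "(\<lambda>n. E (d n - d (Suc n)) f) \<longlonglongrightarrow> 0"
    by (intro summable_LIMSEQ_zero sums_summable)
  then have "\<forall>\<^sub>F n in sequentially. norm (E (d n - d (Suc n)) f) < 1"
    by (drule_tac tendstoD[of _ 0 sequentially 1]) simp_all
  then obtain n where "norm (E (d n - d (Suc n)) f) < 1" by (auto simp: eventually_sequentially)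
  then show False using d(2)[of n] by simp
qed

lemma E_bounded: "\<exists>M\<ge>0. \<forall>\<delta>\<in>sets borel. \<forall>f. norm (E \<delta> f) \<le> M * norm f"
  by (rule uniform_boundedness[OF bounded_linear_E E_pointwise_bounded])

section \<open>Integrals of simple functions\<close>

lemma vimage_sets: "simple_function borel p \<Longrightarrow> p -` S \<in> sets borel"
  using simple_functionD(2)[of borel p S] by simp

lemma simple_range: "simple_function borel p \<Longrightarrow> finite (range p)"
  for p :: "complex \<Rightarrow> 'b"
  using simple_functionD(1)[of borel p] by simp

text \<open>The level sets of \<open>p\<close> may be finer than those of the composite. With
  \<open>p\<close> a pair of simple functions, the integrals of both components, of their sum and of
  their product become sums over one common partition.\<close>

lemma simple_integral_compose:
  assumes p: "simple_function borel p"
  shows "simple_spectral_integral E (\<lambda>z. g (p z)) f = (\<Sum>c\<in>range p. g c *\<^sub>C E (p -` {c}) f)"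
proof -
  have fin: "finite (range p)" by (rule simple_range[OF p])
  have part: "E ((\<lambda>z. g (p z)) -` {d}) f = (\<Sum>c\<in>{c\<in>range p. g c = d}. E (p -` {c}) f)" for d
  proof -
    have "(\<lambda>z. g (p z)) -` {d} = (\<Union>c\<in>{c\<in>range p. g c = d}. p -` {c})" by auto
    then show ?thesis
      using fin vimage_sets[OF p] by (auto simp: disjoint_family_on_def intro!: E_finite_UN)
  qed
  have "(\<Sum>c\<in>range p. g c *\<^sub>C E (p -` {c}) f) =
    (\<Sum>d\<in>g ` range p. \<Sum>c\<in>{c\<in>range p. g c = d}. g c *\<^sub>C E (p -` {c}) f)"
    by (rule sum.image_gen[OF fin])
  also have "\<dots> = (\<Sum>d\<in>g ` range p. d *\<^sub>C E ((\<lambda>z. g (p z)) -` {d}) f)"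
    by (intro sum.cong refl) (auto simp: part scaleC_sum_right)
  finally show ?thesis
    by (simp add: simple_spectral_integral_def image_image)
qed

lemma simple_integral_add:
  assumes "simple_function borel s" "simple_function borel r"
  shows "simple_spectral_integral E (\<lambda>z. s z + r z) f =
    simple_spectral_integral E s f + simple_spectral_integral E r f"
proof -
  have p: "simple_function borel (\<lambda>z. (s z, r z))" using assms by simp
  show ?thesis
    using simple_integral_compose[OF p, of "\<lambda>c. fst c + snd c" f]
      simple_integral_compose[OF p, of fst f] simple_integral_compose[OF p, of snd f]
    by (simp add: scaleC_add_left sum.distrib)
qed

lemma simple_integral_scaleC:
  assumes "simple_function borel s"
  shows "simple_spectral_integral E (\<lambda>z. c * s z) f = c *\<^sub>C simple_spectral_integral E s f"
  using simple_integral_compose[OF assms, of "\<lambda>d. c * d" f]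
  by (simp add: simple_spectral_integral_def scaleC_sum_right scaleC_scaleC)

lemma simple_integral_diff:
  assumes "simple_function borel s" "simple_function borel r"
  shows "simple_spectral_integral E (\<lambda>z. s z - r z) f =
    simple_spectral_integral E s f - simple_spectral_integral E r f"
proof -
  have "simple_function borel (\<lambda>z. (-1) * r z)"
    by (intro simple_function_mult simple_function_const assms)
  from simple_integral_add[OF assms(1) this] show ?thesis
    unfolding simple_integral_scaleC[OF assms(2)] scaleC_minus_one by simp
qed

lemma bounded_linear_simple_integral:
  assumes "simple_function borel s"
  shows "bounded_linear (simple_spectral_integral E s)"
  unfolding simple_spectral_integral_def[abs_def] using vimage_sets[OF assms]
  by (intro bounded_linear_sum bounded_linear_compose[OF bounded_linear_scaleC bounded_linear_E])

lemma simple_integral_mult: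
  assumes "simple_function borel s" "simple_function borel r"
  shows "simple_spectral_integral E (\<lambda>z. s z * r z) f =
    simple_spectral_integral E s (simple_spectral_integral E r f)"
proof -
  let ?p = "\<lambda>z. (s z, r z)"
  have p: "simple_function borel ?p" using assms by simp
  have fin: "finite (range ?p)" by (rule simple_range[OF p])
  have "simple_spectral_integral E s (simple_spectral_integral E r f) =
    (\<Sum>c\<in>range ?p. fst c *\<^sub>C E (?p -` {c}) (\<Sum>d\<in>range ?p. snd d *\<^sub>C E (?p -` {d}) f))"
    using simple_integral_compose[OF p, of fst] simple_integral_compose[OF p, of snd] by simp
  also have "\<dots> = (\<Sum>c\<in>range ?p. (fst c * snd c) *\<^sub>C E (?p -` {c}) f)"
  proof (intro sum.cong refl)
    fix c assume c: "c \<in> range ?p"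
    \<comment> \<open>Only the diagonal term survives: distinct level sets are disjoint, so the
      product of their projections is 0.\<close>
    have "E (?p -` {c}) (\<Sum>d\<in>range ?p. snd d *\<^sub>C E (?p -` {d}) f) =
      (\<Sum>d\<in>range ?p. snd d *\<^sub>C E (?p -` {c} \<inter> ?p -` {d}) f)"
      using vimage_sets[OF p]
      by (simp add: linear_sum[OF bounded_linear.linear[OF bounded_linear_E]] E_scaleC E_Int
          del: vimage_Int)
    also have "\<dots> = (\<Sum>d\<in>range ?p. if d = c then snd c *\<^sub>C E (?p -` {c}) f else 0)"
    proof (intro sum.cong refl)
      fix d show "snd d *\<^sub>C E (?p -` {c} \<inter> ?p -` {d}) f =
        (if d = c then snd c *\<^sub>C E (?p -` {c}) f else 0)"
      proof (cases "d = c")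
        case False
        then have "?p -` {c} \<inter> ?p -` {d} = {}" by auto
        then show ?thesis using False by (simp only: if_False E_empty scaleC_zero_right)
      qed simp
    qed
    also have "\<dots> = snd c *\<^sub>C E (?p -` {c}) f" using fin c by simp
    finally show "fst c *\<^sub>C E (?p -` {c}) (\<Sum>d\<in>range ?p. snd d *\<^sub>C E (?p -` {d}) f) =
      (fst c * snd c) *\<^sub>C E (?p -` {c}) f" by (simp only: scaleC_scaleC)
  qed
  also have "\<dots> = simple_spectral_integral E (\<lambda>z. s z * r z) f"
    using simple_integral_compose[OF p, of "\<lambda>c. fst c * snd c" f] by simp
  finally show ?thesis ..
qed

lemma simple_integral_indicator:
  assumes "\<delta> \<in> sets borel"
  shows "simple_spectral_integral E (indicator \<delta>) f = E \<delta> f"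
proof -
  have p: "simple_function borel (\<lambda>z. z \<in> \<delta>)"
    unfolding simple_function_def using assms by (auto simp: vimage_def Collect_neg_eq[symmetric])
  have eq: "(\<lambda>z. of_bool (z \<in> \<delta>)) = (indicator \<delta> :: complex \<Rightarrow> complex)"
    by (auto simp: indicator_def)
  \<comment> \<open>If \<delta> is empty or the whole plane, one truth value is missing from the
    range; its level set is empty, so summing over both values is harmless.\<close>
  have "(\<Sum>c\<in>range (\<lambda>z. z \<in> \<delta>). of_bool c *\<^sub>C E ((\<lambda>z. z \<in> \<delta>) -` {c}) f) =
    (\<Sum>c\<in>UNIV. of_bool c *\<^sub>C E ((\<lambda>z. z \<in> \<delta>) -` {c}) f)"
  proof (rule sum.mono_neutral_left; safe?)
    fix c assume "c \<notin> range (\<lambda>z. z \<in> \<delta>)"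
    then have "(\<lambda>z. z \<in> \<delta>) -` {c} = {}" by auto
    then show "of_bool c *\<^sub>C E ((\<lambda>z. z \<in> \<delta>) -` {c}) f = 0" by (simp only: E_empty scaleC_zero_right)
  qed auto
  also have "\<dots> = E \<delta> f" by (simp add: UNIV_bool vimage_def)
  finally show ?thesis using simple_integral_compose[OF p, of of_bool f] by (simp add: eq)
qed

text \<open>Estimating term by term would bring in the number of values of \<open>s\<close>.
  Instead, real coefficients are rescaled to the unit cube, where the norm is bounded by its values
  at the vertices; a vertex sum is \<open>E\<close> of a single Borel set, hence at most
  \<open>M * norm f\<close>. Undoing the rescaling costs the factor 3, and real and imaginary parts
  together give 6.\<close>

lemma simple_integral_bounded:
  "\<exists>N\<ge>0. \<forall>s K f. simple_function borel s \<longrightarrow> (\<forall>z. cmod (s z) \<le> K) \<longrightarrow>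
    norm (simple_spectral_integral E s f) \<le> N * K * norm f"
proof -
  obtain M where M: "M \<ge> 0" "\<And>\<delta> f. \<delta> \<in> sets borel \<Longrightarrow> norm (E \<delta> f) \<le> M * norm f"
    using E_bounded by blast
  have "norm (simple_spectral_integral E s f) \<le> (6 * M) * K * norm f"
    if s: "simple_function borel s" and K: "\<And>z. cmod (s z) \<le> K" for s K f
  proof -
    let ?x = "\<lambda>c. E (s -` {c}) f"
    have K0: "K \<ge> 0" using K norm_ge_zero order_trans by blast
    have fin: "finite (range s)" by (rule simple_range[OF s])
    have sub: "norm (sum ?x J) \<le> M * norm f" if "J \<subseteq> range s" for J
    proof -
      have "sum ?x J = E (\<Union>c\<in>J. s -` {c}) f"
        using that fin finite_subset vimage_sets[OF s]
        by (intro E_finite_UN[symmetric]) (auto simp: disjoint_family_on_def)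
      also have "(\<Union>c\<in>J. s -` {c}) = s -` J" by auto
      finally show ?thesis using M(2) vimage_sets[OF s] by simp
    qed
    have real_bound: "norm (\<Sum>c\<in>range s. d c *\<^sub>R ?x c) \<le> 3 * M * K * norm f"
      if d: "\<And>c. c \<in> range s \<Longrightarrow> \<bar>d c\<bar> \<le> K" for d :: "complex \<Rightarrow> real"
    proof (cases "K = 0")
      case True
      then show ?thesis using d by simp
    next
      case False
      \<comment> \<open>The affine map from \<open>[-K, K]\<close> onto \<open>[0, 1]\<close>. Its
        inverse expresses the sum through twice a cube point minus the all-ones vertex, whence 2 + 1
        = 3.\<close>
      define b where "b c = (d c / K + 1) / 2" for c
      have "norm (0 + (\<Sum>c\<in>range s. b c *\<^sub>R ?x c)) \<le> M * norm f"
      proof (rule norm_cube_sum_le[OF fin])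
        fix c assume "c \<in> range s"
        then have "\<bar>d c / K\<bar> \<le> 1" using d K0 False by (simp add: abs_divide)
        then have "d c / K \<le> 1 \<and> - (d c / K) \<le> 1" by (simp only: abs_le_iff)
        then show "0 \<le> b c \<and> b c \<le> 1" by (auto simp: b_def)
      qed (use sub in simp)
      moreover have "(\<Sum>c\<in>range s. d c *\<^sub>R ?x c) =
        K *\<^sub>R (2 *\<^sub>R (\<Sum>c\<in>range s. b c *\<^sub>R ?x c) - (\<Sum>c\<in>range s. ?x c))"
      proof -
        have "d c = K * (2 * b c - 1)" for c using False by (simp add: b_def field_simps)
        then show ?thesis
          by (simp add: scaleR_sum_right sum_subtractf[symmetric] scaleR_diff_left scaleR_diff_right right_diff_distrib)
      qed
      moreover have "norm (2 *\<^sub>R (\<Sum>c\<in>range s. b c *\<^sub>R ?x c) - (\<Sum>c\<in>range s. ?x c)) \<le> 3 * (M * norm f)"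
        using calculation(1) sub[of "range s"]
          norm_triangle_ineq4[of "2 *\<^sub>R (\<Sum>c\<in>range s. b c *\<^sub>R ?x c)" "\<Sum>c\<in>range s. ?x c"]
        by simp
      ultimately have "norm (\<Sum>c\<in>range s. d c *\<^sub>R ?x c) \<le> K * (3 * (M * norm f))"
        using K0 by (simp add: mult_left_mono)
      then show ?thesis by (simp add: mult_ac)
    qed
    have "simple_spectral_integral E s f =
      (\<Sum>c\<in>range s. Re c *\<^sub>R ?x c) + \<i> *\<^sub>C (\<Sum>c\<in>range s. Im c *\<^sub>R ?x c)"
      unfolding simple_spectral_integral_def scaleC_sum_right sum.distrib[symmetric]
      by (intro sum.cong refl scaleC_complex_split)
    also have "norm \<dots> \<le> 3 * M * K * norm f + 3 * M * K * norm f"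
      using K abs_Re_le_cmod abs_Im_le_cmod
      by (intro norm_triangle_le add_mono)
        (auto simp: norm_scaleC intro!: real_bound intro: order_trans)
    finally show ?thesis by (simp add: mult_ac)
  qed
  then show ?thesis using M(1) by (intro exI[of _ "6 * M"]) auto
qed

end

section \<open>Integrals of bounded Borel functions\<close>

definition bounded_borel :: "(complex \<Rightarrow> complex) \<Rightarrow> bool"
  where "bounded_borel F \<longleftrightarrow> F \<in> borel_measurable borel \<and> (\<exists>K. \<forall>z. cmod (F z) \<le> K)"

lemma bounded_borelI:
  "F \<in> borel_measurable borel \<Longrightarrow> (\<And>z. cmod (F z) \<le> K) \<Longrightarrow> bounded_borel F"
  by (auto simp: bounded_borel_def)

lemma bounded_borel_measurable: "bounded_borel F \<Longrightarrow> F \<in> borel_measurable borel"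
  by (simp add: bounded_borel_def)

lemma bounded_borel_bound:
  assumes "bounded_borel F"
  obtains K where "K \<ge> 0" "\<And>z. cmod (F z) \<le> K"
  using assms norm_ge_zero order_trans unfolding bounded_borel_def by metis

lemma bounded_borel_const [simp]: "bounded_borel (\<lambda>z. c)"
  by (rule bounded_borelI[where K = "cmod c"]) auto

lemma bounded_borel_indicator: "\<delta> \<in> sets borel \<Longrightarrow> bounded_borel (indicator \<delta>)"
  by (rule bounded_borelI[where K = 1]) (auto simp: indicator_def)

lemma bounded_borel_add:
  assumes "bounded_borel F" "bounded_borel G"
  shows "bounded_borel (\<lambda>z. F z + G z)"
proof -
  obtain K L where "\<And>z. cmod (F z) \<le> K" "\<And>z. cmod (G z) \<le> L"
    using assms bounded_borel_bound by metis
  moreover have [measurable]: "F \<in> borel_measurable borel" "G \<in> borel_measurable borel"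
    using assms by (simp_all add: bounded_borel_measurable)
  ultimately show ?thesis
    by (intro bounded_borelI[where K = "K + L"])
      (auto intro!: norm_triangle_le add_mono)
qed

lemma bounded_borel_mult:
  assumes "bounded_borel F" "bounded_borel G"
  shows "bounded_borel (\<lambda>z. F z * G z)"
proof -
  obtain K L where "\<And>z. cmod (F z) \<le> K" "\<And>z. cmod (G z) \<le> L" "K \<ge> 0"
    using assms bounded_borel_bound by metis
  moreover have [measurable]: "F \<in> borel_measurable borel" "G \<in> borel_measurable borel"
    using assms by (simp_all add: bounded_borel_measurable)
  ultimately show ?thesis
    by (intro bounded_borelI[where K = "K * L"])
      (auto simp: norm_mult intro!: mult_mono)
qed

lemma bounded_borel_diff:
  assumes "bounded_borel F" "bounded_borel G"
  shows "bounded_borel (\<lambda>z. F z - G z)"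
  using bounded_borel_add[OF assms(1) bounded_borel_mult[OF bounded_borel_const[of "-1"] assms(2)]]
  by simp

lemma bounded_borel_simple:
  assumes "simple_function borel s"
  shows "bounded_borel s"
proof -
  have "finite (cmod ` range s)" using simple_functionD(1)[OF assms] by simp
  then have "cmod (s z) \<le> Max (cmod ` range s)" for z by (intro Max_ge) auto
  moreover have "s \<in> borel_measurable borel" using assms by (rule borel_measurable_simple_function)
  ultimately show ?thesis by (auto intro: bounded_borelI)
qed

text \<open>A canonical approximation: followed by this rounding, any bounded function takes
  finitely many values, with an error depending on \<open>n\<close> alone. \<open>Suc n\<close>
  keeps the mesh meaningful at \<open>n = 0\<close>.\<close>

definition grid :: "nat \<Rightarrow> complex \<Rightarrow> complex" where
  "grid n w = Complex (of_int \<lfloor>real (Suc n) * Re w\<rfloor> / real (Suc n)) (of_int \<lfloor>real (Suc n) * Im w\<rfloor> / real (Suc n))"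

lemma grid_error: "cmod (grid n w - w) \<le> 2 / real (Suc n)"
proof -
  have fl: "\<bar>of_int \<lfloor>real (Suc n) * x\<rfloor> / real (Suc n) - x\<bar> \<le> 1 / real (Suc n)" for x :: real
  proof -
    have "of_int \<lfloor>real (Suc n) * x\<rfloor> / real (Suc n) - x =
      (of_int \<lfloor>real (Suc n) * x\<rfloor> - real (Suc n) * x) / real (Suc n)"
      by (simp add: diff_divide_distrib)
    moreover have "\<bar>of_int \<lfloor>real (Suc n) * x\<rfloor> - real (Suc n) * x\<bar> \<le> 1" by linarith
    ultimately show ?thesis by (simp only: abs_divide) (simp add: divide_right_mono)
  qed
  show ?thesis
    using cmod_le[of "grid n w - w"] fl[of "Re w"] fl[of "Im w"]
    by (simp add: grid_def)
qed

lemma simple_function_grid: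
  assumes "bounded_borel F"
  shows "simple_function borel (\<lambda>z. grid n (F z))"
proof (rule simple_function_borel_measurable)
  have [measurable]: "F \<in> borel_measurable borel" using assms by (rule bounded_borel_measurable)
  show "(\<lambda>z. grid n (F z)) \<in> borel_measurable borel"
    unfolding grid_def Complex_eq by measurable
  obtain K where K: "\<And>z. cmod (F z) \<le> K" using assms bounded_borel_bound by metis
  define k where "k = \<lceil>real (Suc n) * K\<rceil> + 1"
  have rng: "\<lfloor>real (Suc n) * x\<rfloor> \<in> {-k..k}" if "\<bar>x\<bar> \<le> K" for x
  proof -
    have "\<bar>real (Suc n) * x\<bar> \<le> real (Suc n) * K" using that by (simp only: abs_mult) (simp add: mult_left_mono)
    then show ?thesis unfolding k_def by simp linarith
  qed
  have "range (\<lambda>z. grid n (F z)) \<subseteq>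
    (\<lambda>(a, b). Complex (of_int a / real (Suc n)) (of_int b / real (Suc n))) ` ({-k..k} \<times> {-k..k})"
  proof safe
    fix z
    have "\<bar>Re (F z)\<bar> \<le> K" "\<bar>Im (F z)\<bar> \<le> K"
      using K[of z] abs_Re_le_cmod[of "F z"] abs_Im_le_cmod[of "F z"] by linarith+
    then show "grid n (F z) \<in>
      (\<lambda>(a, b). Complex (of_int a / real (Suc n)) (of_int b / real (Suc n))) ` ({-k..k} \<times> {-k..k})"
      unfolding grid_def using rng by (intro image_eqI[of _ _ "(\<lfloor>real (Suc n) * Re (F z)\<rfloor>, \<lfloor>real (Suc n) * Im (F z)\<rfloor>)"]) auto
  qed
  then show "finite ((\<lambda>z. grid n (F z)) ` space borel)"
    by (simp add: finite_subset)
qed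

lemma two_over_Suc_tendsto: "(\<lambda>n. 2 / real (Suc n)) \<longlonglongrightarrow> 0"
  using tendsto_mult[OF tendsto_const[of "2::real"] LIMSEQ_inverse_real_of_nat] by (simp add: divide_inverse)

lemma grid_uniform_limit: "uniform_limit S (\<lambda>n z. grid n (F z)) F sequentially"
  unfolding uniform_limit_iff
proof (intro allI impI)
  fix e :: real assume "e > 0"
  from order_tendstoD(2)[OF two_over_Suc_tendsto this]
  show "\<forall>\<^sub>F n in sequentially. \<forall>x\<in>S. dist (grid n (F x)) (F x) < e"
    by eventually_elim (auto simp: dist_norm intro: order.strict_trans1[OF grid_error])
qed

section \<open>The bounded multiplicative calculus\<close>

context spectral_measure_space
begin

definition opbound :: real where
  "opbound = (SOME N. N \<ge> 0 \<and> (\<forall>s K f. simple_function borel s \<longrightarrow> (\<forall>z. cmod (s z) \<le> K) \<longrightarrow>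
    norm (simple_spectral_integral E s f) \<le> N * K * norm f))"

lemma opbound_nonneg: "opbound \<ge> 0"
  and simple_integral_le: "simple_function borel s \<Longrightarrow> (\<And>z. cmod (s z) \<le> K) \<Longrightarrow>
    norm (simple_spectral_integral E s f) \<le> opbound * K * norm f"
  using someI_ex[OF simple_integral_bounded] unfolding opbound_def[symmetric] by blast+

lemma opbound_small:
  assumes "e > 0"
  shows "\<exists>d>0. opbound * d * norm f < e"
proof -
  \<comment> \<open>The added 1 keeps the denominator positive when \<open>opbound * norm f\<close>
    is 0 and makes the final inequality strict.\<close>
  have "opbound * (e / (opbound * norm f + 1)) * norm f = e * ((opbound * norm f) / (opbound * norm f + 1))"
    by simp
  also have "\<dots> < e * 1"
    using assms opbound_nonneg
    by (intro mult_strict_left_mono) (simp_all add: divide_less_eq add_nonneg_pos)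
  finally show ?thesis
    using assms opbound_nonneg by (intro exI[of _ "e / (opbound * norm f + 1)"]) (simp add: add_nonneg_pos)
qed

text \<open>A pointwise limit along one fixed approximation avoids the definite description in
  \<open>spectral_integral\<close>; \<open>spectral_integral_eq_Phi\<close> reconciles the
  two.\<close>

definition Phi :: "(complex \<Rightarrow> complex) \<Rightarrow> 'a \<Rightarrow> 'a" where
  "Phi F f = lim (\<lambda>n. simple_spectral_integral E (\<lambda>z. grid n (F z)) f)"

lemma simple_integral_dist:
  assumes "simple_function borel s" "simple_function borel r" "\<And>z. cmod (s z - r z) \<le> K"
  shows "norm (simple_spectral_integral E s f - simple_spectral_integral E r f) \<le> opbound * K * norm f"
  using simple_integral_le[of "\<lambda>z. s z - r z" K f] assms by (simp add: simple_integral_diff)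

lemma simple_integral_convergent:
  assumes s: "\<And>n. simple_function borel (s n)" and lim: "uniform_limit UNIV s F sequentially"
  shows "convergent (\<lambda>n. simple_spectral_integral E (s n) f)"
proof (rule Cauchy_convergent, rule metric_CauchyI)
  fix e :: real assume "e > 0"
  then obtain d where d: "d > 0" "opbound * d * norm f < e" using opbound_small by blast
  obtain n0 where n0: "\<And>n z. n \<ge> n0 \<Longrightarrow> dist (s n z) (F z) < d / 2"
    using lim \<open>d > 0\<close> unfolding uniform_limit_iff eventually_sequentially by (metis UNIV_I half_gt_zero)
  have "dist (simple_spectral_integral E (s m) f) (simple_spectral_integral E (s n) f) < e"
    if "m \<ge> n0" "n \<ge> n0" for m n
  proof -
    have "cmod (s m z - s n z) \<le> d" for z
      using n0[OF that(1), of z] n0[OF that(2), of z]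
        dist_triangle2[of "s m z" "s n z" "F z"] by (simp add: dist_norm)
    from simple_integral_dist[OF s s this] show ?thesis
      using d(2) by (simp add: dist_norm) (meson order.strict_trans1)
  qed
  then show "\<exists>M. \<forall>m\<ge>M. \<forall>n\<ge>M.
    dist (simple_spectral_integral E (s m) f) (simple_spectral_integral E (s n) f) < e" by blast
qed

text \<open>Interleaving two approximating sequences shows that they give the same limit.\<close>

lemma simple_integral_tendsto_Phi:
  assumes F: "bounded_borel F" and s: "\<And>n. simple_function borel (s n)"
    and lim: "uniform_limit UNIV s F sequentially"
  shows "(\<lambda>n. simple_spectral_integral E (s n) f) \<longlonglongrightarrow> Phi F f"
proof -
  let ?r = "\<lambda>n. if even n then s (n div 2) else (\<lambda>z. grid (n div 2) (F z))"
  have r: "simple_function borel (?r n)" for n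
    using s simple_function_grid[OF F] by simp
  have "uniform_limit UNIV ?r F sequentially"
    unfolding uniform_limit_iff
  proof (intro allI impI)
    fix e :: real assume "e > 0"
    then have "\<forall>\<^sub>F n in sequentially. (\<forall>z. dist (s n z) (F z) < e) \<and> (\<forall>z. dist (grid n (F z)) (F z) < e)"
      using lim grid_uniform_limit[where S = UNIV and F = F] unfolding uniform_limit_iff by (auto simp: eventually_conj_iff)
    then obtain n0 where
      "\<And>n. n \<ge> n0 \<Longrightarrow> (\<forall>z. dist (s n z) (F z) < e) \<and> (\<forall>z. dist (grid n (F z)) (F z) < e)"
      unfolding eventually_sequentially by blast
    \<comment> \<open>The term of index \<open>n\<close> comes from position \<open>n div 2\<close>
      of its sequence, hence the doubled threshold.\<close>
    then have "\<forall>n\<ge>2 * n0. \<forall>z\<in>UNIV. dist (?r n z) (F z) < e" by auto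
    then show "\<forall>\<^sub>F n in sequentially. \<forall>z\<in>UNIV. dist (?r n z) (F z) < e"
      unfolding eventually_sequentially by blast
  qed
  then obtain L where L: "(\<lambda>n. simple_spectral_integral E (?r n) f) \<longlonglongrightarrow> L"
    using simple_integral_convergent[of ?r F f] r unfolding convergent_def by blast
  have "(\<lambda>n. simple_spectral_integral E (s n) f) \<longlonglongrightarrow> L"
    using LIMSEQ_subseq_LIMSEQ[OF L, of "\<lambda>n. 2 * n"] by (simp add: strict_mono_def o_def)
  moreover have "(\<lambda>n. simple_spectral_integral E (\<lambda>z. grid n (F z)) f) \<longlonglongrightarrow> L"
    using LIMSEQ_subseq_LIMSEQ[OF L, of "\<lambda>n. 2 * n + 1"] by (simp add: strict_mono_def o_def)
  ultimately show ?thesis unfolding Phi_def using limI by metis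
qed

lemma grid_integral_tendsto_Phi:
  "bounded_borel F \<Longrightarrow> (\<lambda>n. simple_spectral_integral E (\<lambda>z. grid n (F z)) f) \<longlonglongrightarrow> Phi F f"
  by (intro simple_integral_tendsto_Phi simple_function_grid grid_uniform_limit)

lemma Phi_simple: "simple_function borel s \<Longrightarrow> Phi s f = simple_spectral_integral E s f"
  using simple_integral_tendsto_Phi[of s "\<lambda>_. s" f]
  by (simp add: bounded_borel_simple uniform_limit_const LIMSEQ_const_iff)

lemma Phi_indicator: "\<delta> \<in> sets borel \<Longrightarrow> Phi (indicator \<delta>) f = E \<delta> f"
  by (subst Phi_simple) (auto simp: simple_integral_indicator
      intro!: simple_function_borel_measurable finite_subset[of _ "{0, 1}"] split: split_indicator)

lemma Phi_const: "Phi (\<lambda>z. c) f = c *\<^sub>C f"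
  by (subst Phi_simple) (auto simp: simple_spectral_integral_def)

lemma Phi_norm_le:
  assumes F: "bounded_borel F" and K: "\<And>z. cmod (F z) \<le> K"
  shows "norm (Phi F f) \<le> opbound * K * norm f"
proof (rule LIMSEQ_le)
  show "(\<lambda>n. norm (simple_spectral_integral E (\<lambda>z. grid n (F z)) f)) \<longlonglongrightarrow> norm (Phi F f)"
    by (intro tendsto_norm grid_integral_tendsto_Phi F)
  have "(\<lambda>n. opbound * (K + 2 / real (Suc n)) * norm f) \<longlonglongrightarrow> opbound * (K + 0) * norm f"
    by (intro tendsto_intros two_over_Suc_tendsto)
  then show "(\<lambda>n. opbound * (K + 2 / real (Suc n)) * norm f) \<longlonglongrightarrow> opbound * K * norm f" by simp
  have "cmod (grid n (F z)) \<le> K + 2 / real (Suc n)" for n z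
    using grid_error[of n "F z"] K[of z] norm_triangle_sub[of "grid n (F z)" "F z"] by linarith
  then show "\<exists>N. \<forall>n\<ge>N. norm (simple_spectral_integral E (\<lambda>z. grid n (F z)) f) \<le>
    opbound * (K + 2 / real (Suc n)) * norm f"
    by (intro exI[of _ 0] allI impI simple_integral_le simple_function_grid F)
qed

lemma Phi_add:
  assumes F: "bounded_borel F" and G: "bounded_borel G"
  shows "Phi (\<lambda>z. F z + G z) f = Phi F f + Phi G f"
proof (rule LIMSEQ_unique)
  let ?s = "\<lambda>n z. grid n (F z) + grid n (G z)"
  have "uniform_limit UNIV ?s (\<lambda>z. F z + G z) sequentially"
    by (intro uniform_limit_intros grid_uniform_limit)
  then show "(\<lambda>n. simple_spectral_integral E (?s n) f) \<longlonglongrightarrow> Phi (\<lambda>z. F z + G z) f"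
    using F G by (intro simple_integral_tendsto_Phi bounded_borel_add simple_function_add simple_function_grid)
  show "(\<lambda>n. simple_spectral_integral E (?s n) f) \<longlonglongrightarrow> Phi F f + Phi G f"
    unfolding simple_integral_add[OF simple_function_grid[OF F] simple_function_grid[OF G]]
    by (intro tendsto_add grid_integral_tendsto_Phi F G)
qed

lemma bounded_linear_Phi:
  assumes F: "bounded_borel F"
  shows "bounded_linear (Phi F)"
proof -
  obtain K where K: "\<And>z. cmod (F z) \<le> K" using F bounded_borel_bound by metis
  let ?s = "\<lambda>n. simple_spectral_integral E (\<lambda>z. grid n (F z))"
  have lin: "bounded_linear (?s n)" for n
    by (intro bounded_linear_simple_integral simple_function_grid F)
  show ?thesis
  proof (rule bounded_linear_intro)
    fix x y :: 'a and r :: real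
    show "Phi F (x + y) = Phi F x + Phi F y"
    proof (rule LIMSEQ_unique)
      show "(\<lambda>n. ?s n (x + y)) \<longlonglongrightarrow> Phi F (x + y)" by (rule grid_integral_tendsto_Phi[OF F])
      show "(\<lambda>n. ?s n (x + y)) \<longlonglongrightarrow> Phi F x + Phi F y"
        unfolding linear_add[OF bounded_linear.linear[OF lin]]
        by (intro tendsto_add grid_integral_tendsto_Phi F)
    qed
    show "Phi F (r *\<^sub>R x) = r *\<^sub>R Phi F x"
    proof (rule LIMSEQ_unique)
      show "(\<lambda>n. ?s n (r *\<^sub>R x)) \<longlonglongrightarrow> Phi F (r *\<^sub>R x)" by (rule grid_integral_tendsto_Phi[OF F])
      show "(\<lambda>n. ?s n (r *\<^sub>R x)) \<longlonglongrightarrow> r *\<^sub>R Phi F x"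
        unfolding linear_scale[OF bounded_linear.linear[OF lin]]
        by (intro tendsto_scaleR tendsto_const grid_integral_tendsto_Phi F)
    qed
    show "norm (Phi F x) \<le> norm x * (opbound * K)"
      using Phi_norm_le[OF F K, of x] by (simp add: mult_ac)
  qed
qed

lemma Phi_linear_simps:
  assumes "bounded_borel F"
  shows "Phi F (x + y) = Phi F x + Phi F y" "Phi F (x - y) = Phi F x - Phi F y"
  using bounded_linear.linear[OF bounded_linear_Phi[OF assms]] by (simp_all add: linear_add linear_diff)

lemma Phi_mult:
  assumes F: "bounded_borel F" and G: "bounded_borel G"
  shows "Phi (\<lambda>z. F z * G z) f = Phi F (Phi G f)"
proof (rule LIMSEQ_unique)
  let ?I = "simple_spectral_integral E"
  let ?s = "\<lambda>n z. grid n (F z)" and ?r = "\<lambda>n z. grid n (G z)"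
  obtain K where K: "K \<ge> 0" "\<And>z. cmod (F z) \<le> K" using F bounded_borel_bound by metis
  obtain L where L: "L \<ge> 0" "\<And>z. cmod (G z) \<le> L" using G bounded_borel_bound by metis
  have "uniform_limit UNIV (\<lambda>n z. ?s n z * ?r n z) (\<lambda>z. F z * G z) sequentially"
    using K L by (intro uniform_lim_mult grid_uniform_limit) (auto simp: bounded_iff)
  then show "(\<lambda>n. ?I (\<lambda>z. ?s n z * ?r n z) f) \<longlonglongrightarrow> Phi (\<lambda>z. F z * G z) f"
    using F G by (intro simple_integral_tendsto_Phi bounded_borel_mult simple_function_mult simple_function_grid)
  \<comment> \<open>Operator and vector vary together, so the vector is first replaced by its limit.
    The error vanishes because the operators are uniformly bounded: rounding raises the bound
    \<open>K\<close> by at most 2.\<close>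
  have "(\<lambda>n. ?I (?s n) (?I (?r n) f - Phi G f)) \<longlonglongrightarrow> 0"
  proof (rule Lim_null_comparison)
    have "cmod (grid n (F z)) \<le> K + 2" for n z
    proof -
      have "2 / real (Suc n) \<le> 2" by (simp add: field_simps)
      then show ?thesis
        using grid_error[of n "F z"] K(2)[of z] norm_triangle_sub[of "grid n (F z)" "F z"] by linarith
    qed
    then show "\<forall>\<^sub>F n in sequentially. norm (?I (?s n) (?I (?r n) f - Phi G f)) \<le>
      opbound * (K + 2) * norm (?I (?r n) f - Phi G f)"
      by (intro always_eventually allI simple_integral_le simple_function_grid F)
    have "(\<lambda>n. opbound * (K + 2) * norm (?I (?r n) f - Phi G f)) \<longlonglongrightarrow>
      opbound * (K + 2) * norm (Phi G f - Phi G f)"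
      by (intro tendsto_intros grid_integral_tendsto_Phi G)
    then show "(\<lambda>n. opbound * (K + 2) * norm (?I (?r n) f - Phi G f)) \<longlonglongrightarrow> 0" by simp
  qed
  then have "(\<lambda>n. ?I (?s n) (?I (?r n) f - Phi G f) + ?I (?s n) (Phi G f)) \<longlonglongrightarrow> 0 + Phi F (Phi G f)"
    by (intro tendsto_add grid_integral_tendsto_Phi F)
  then show "(\<lambda>n. ?I (\<lambda>z. ?s n z * ?r n z) f) \<longlonglongrightarrow> Phi F (Phi G f)"
    using linear_diff[OF bounded_linear.linear[OF bounded_linear_simple_integral[OF simple_function_grid[OF F]]]]
    by (simp add: simple_integral_mult[OF simple_function_grid[OF F] simple_function_grid[OF G]])
qed

text \<open>Both are instances of multiplicativity, since a constant function acts as scalar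
  multiplication.\<close>

lemma Phi_scaleC:
  assumes F: "bounded_borel F"
  shows "Phi F (c *\<^sub>C f) = c *\<^sub>C Phi F f" "Phi (\<lambda>z. c * F z) f = c *\<^sub>C Phi F f"
  using Phi_mult[OF F bounded_borel_const, of c f] Phi_mult[OF bounded_borel_const F, of c f]
  by (simp_all add: Phi_const mult.commute)

lemma Phi_diff:
  assumes F: "bounded_borel F" and G: "bounded_borel G"
  shows "Phi (\<lambda>z. F z - G z) f = Phi F f - Phi G f"
  using Phi_add[OF F bounded_borel_mult[OF bounded_borel_const G], of "-1" f] Phi_scaleC(2)[OF G, of "-1" f]
  by (simp add: scaleC_minus_one)

lemma Phi_commute:
  assumes "bounded_borel F" "bounded_borel G"
  shows "Phi F (Phi G f) = Phi G (Phi F f)"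
  using Phi_mult[OF assms, of f] Phi_mult[OF assms(2,1), of f] by (simp add: mult.commute)

text \<open>Joint continuity in function and vector, needed because both move in the difference
  quotients of the comparison with the semigroup. The difference \<open>G x - F\<close> is applied
  to \<open>f\<close> and to \<open>g x - f\<close> separately: the first term is small by uniform
  convergence, the second because \<open>g x\<close> tends to \<open>f\<close>.\<close>

lemma Phi_tendsto:
  assumes G: "\<And>x. bounded_borel (G x)" and F: "bounded_borel F"
    and lim: "uniform_limit UNIV G F net" and g: "(g \<longlongrightarrow> f) net"
  shows "((\<lambda>x. Phi (G x) (g x)) \<longlongrightarrow> Phi F f) net"
proof -
  have "((\<lambda>x. Phi (\<lambda>z. G x z - F z) f) \<longlongrightarrow> 0) net" for f
  proof (rule tendstoI)
    fix e :: real assume "e > 0"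
    then obtain d where d: "d > 0" "opbound * d * norm f < e" using opbound_small by blast
    have "\<forall>\<^sub>F x in net. \<forall>z\<in>UNIV. dist (G x z) (F z) < d"
      using lim d(1) unfolding uniform_limit_iff by blast
    then show "\<forall>\<^sub>F x in net. dist (Phi (\<lambda>z. G x z - F z) f) 0 < e"
    proof eventually_elim
      case (elim x)
      have "norm (Phi (\<lambda>z. G x z - F z) f) \<le> opbound * d * norm f"
        using elim by (intro Phi_norm_le bounded_borel_diff G F) (auto simp: dist_norm less_imp_le)
      then show ?case using d(2) by simp
    qed
  qed
  then have "((\<lambda>x. Phi (\<lambda>z. G x z - F z) f) \<longlongrightarrow> 0) net" .
  moreover have "((\<lambda>x. Phi (\<lambda>z. G x z - F z) (g x - f)) \<longlongrightarrow> 0) net"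
  proof (rule Lim_null_comparison)
    have "\<forall>\<^sub>F x in net. \<forall>z\<in>UNIV. dist (G x z) (F z) < 1"
      using uniform_limitD[OF lim, of 1] by simp
    then show "\<forall>\<^sub>F x in net. norm (Phi (\<lambda>z. G x z - F z) (g x - f)) \<le> opbound * 1 * norm (g x - f)"
    proof eventually_elim
      case (elim x)
      then show ?case
        by (intro Phi_norm_le bounded_borel_diff G F) (auto simp: dist_norm less_imp_le)
    qed
    have "((\<lambda>x. opbound * 1 * norm (g x - f)) \<longlongrightarrow> opbound * 1 * norm (f - f)) net"
      by (intro tendsto_intros g)
    then show "((\<lambda>x. opbound * 1 * norm (g x - f)) \<longlongrightarrow> 0) net" by simp
  qed
  moreover have "((\<lambda>x. Phi F (g x)) \<longlongrightarrow> Phi F f) net"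
    by (rule bounded_linear.tendsto[OF bounded_linear_Phi[OF F] g])
  ultimately have "((\<lambda>x. Phi (\<lambda>z. G x z - F z) f + Phi (\<lambda>z. G x z - F z) (g x - f) + Phi F (g x)) \<longlongrightarrow>
    0 + 0 + Phi F f) net"
    by (intro tendsto_add)
  then show ?thesis
    using G F by (simp add: Phi_diff Phi_linear_simps)
qed

text \<open>The grid converges in operator norm at the explicit rate
  \<open>opbound * (2 / real (Suc n))\<close>, which gives existence. Any other candidate is a
  pointwise limit of simple integrals, and these limits do not depend on the approximating
  sequence.\<close>

lemma spectral_integral_eq_Phi:
  assumes F: "bounded_borel F"
  shows "spectral_integral E F = Phi F"
  unfolding spectral_integral_def
proof (rule the_equality)
  let ?I = "simple_spectral_integral E"
  have norm_le: "norm (?I (\<lambda>z. grid n (F z)) f - Phi F f) \<le> opbound * (2 / real (Suc n)) * norm f" for n f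
  proof -
    have "?I (\<lambda>z. grid n (F z)) f - Phi F f = Phi (\<lambda>z. grid n (F z) - F z) f"
      using simple_function_grid[OF F, of n] F by (simp add: Phi_diff bounded_borel_simple Phi_simple)
    then show ?thesis
      using Phi_norm_le[OF bounded_borel_diff[OF bounded_borel_simple[OF simple_function_grid[OF F]] F] grid_error]
      by simp
  qed
  have "(\<lambda>n. onorm (\<lambda>f. ?I (\<lambda>z. grid n (F z)) f - Phi F f)) \<longlonglongrightarrow> 0"
  proof (rule Lim_null_comparison)
    show "\<forall>\<^sub>F n in sequentially. norm (onorm (\<lambda>f. ?I (\<lambda>z. grid n (F z)) f - Phi F f)) \<le>
      opbound * (2 / real (Suc n))"
    proof (rule always_eventually, rule allI)
      fix n
      have "bounded_linear (\<lambda>f. ?I (\<lambda>z. grid n (F z)) f - Phi F f)"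
        by (intro bounded_linear_sub bounded_linear_simple_integral simple_function_grid bounded_linear_Phi F)
      moreover have "onorm (\<lambda>f. ?I (\<lambda>z. grid n (F z)) f - Phi F f) \<le> opbound * (2 / real (Suc n))"
        by (intro onorm_bound norm_le mult_nonneg_nonneg opbound_nonneg) simp
      ultimately show "norm (onorm (\<lambda>f. ?I (\<lambda>z. grid n (F z)) f - Phi F f)) \<le> opbound * (2 / real (Suc n))"
        by (simp only: real_norm_def abs_of_nonneg onorm_pos_le)
    qed
    have "(\<lambda>n. opbound * (2 / real (Suc n))) \<longlonglongrightarrow> opbound * 0"
      by (intro tendsto_intros two_over_Suc_tendsto)
    then show "(\<lambda>n. opbound * (2 / real (Suc n))) \<longlonglongrightarrow> 0" by simp
  qed
  moreover have "bounded_clinear (Phi F)"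
    by (simp add: bounded_clinear_def bounded_linear_Phi F Phi_scaleC)
  ultimately show "has_spectral_integral E F (Phi F)"
    unfolding has_spectral_integral_def
    using simple_function_grid[OF F] grid_uniform_limit[where S = UNIV and F = F]
    by (intro conjI exI[of _ "\<lambda>n z. grid n (F z)"] allI)
next
  fix S assume "has_spectral_integral E F S"
  then obtain s where S: "bounded_linear S" and s: "\<And>n. simple_function borel (s n)"
    "uniform_limit UNIV s F sequentially"
    "(\<lambda>n. onorm (\<lambda>f. simple_spectral_integral E (s n) f - S f)) \<longlonglongrightarrow> 0"
    unfolding has_spectral_integral_def bounded_clinear_def by blast
  show "S = Phi F"
  proof
    fix f
    have "(\<lambda>n. simple_spectral_integral E (s n) f - S f) \<longlonglongrightarrow> 0"
    proof (rule Lim_null_comparison)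
      show "\<forall>\<^sub>F n in sequentially. norm (simple_spectral_integral E (s n) f - S f) \<le>
        onorm (\<lambda>f. simple_spectral_integral E (s n) f - S f) * norm f"
        by (intro always_eventually allI onorm[of "\<lambda>f. simple_spectral_integral E (s _) f - S f"]
            bounded_linear_sub bounded_linear_simple_integral s S)
      show "(\<lambda>n. onorm (\<lambda>f. simple_spectral_integral E (s n) f - S f) * norm f) \<longlonglongrightarrow> 0"
        using tendsto_mult[OF s(3) tendsto_const] by simp
    qed
    then have "(\<lambda>n. simple_spectral_integral E (s n) f) \<longlonglongrightarrow> S f" by (simp add: LIM_zero_iff)
    then show "S f = Phi F f"
      using simple_integral_tendsto_Phi[OF F s(1,2)] LIMSEQ_unique by blast
  qed
qed

end

section \<open>Cut-off functions and semigroups\<close>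

lemma closed_operatorD:
  assumes "closed_operator D B" "\<And>n::nat. x n \<in> D" "x \<longlonglongrightarrow> a" "(\<lambda>n. B (x n)) \<longlonglongrightarrow> b"
  shows "a \<in> D" "B a = b"
proof -
  have "(a, b) \<in> (\<lambda>f. (f, B f)) ` D"
  proof (rule closed_sequentially[OF assms(1)[unfolded closed_operator_def]])
    show "(\<lambda>n. (x n, B (x n))) \<longlonglongrightarrow> (a, b)" by (rule tendsto_Pair[OF assms(3,4)])
  qed (use assms(2) in blast)
  then show "a \<in> D" "B a = b" by auto
qed

lemma uniform_limit_bound:
  fixes G :: "'s \<Rightarrow> 'x \<Rightarrow> 'b::metric_space"
  assumes "\<forall>\<^sub>F s in net. \<forall>x\<in>X. dist (G s x) (F x) \<le> k s" "(k \<longlongrightarrow> 0) net"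
  shows "uniform_limit X G F net"
  unfolding uniform_limit_iff
proof (intro allI impI)
  fix e :: real assume "e > 0"
  from order_tendstoD(2)[OF assms(2) this] assms(1)
  show "\<forall>\<^sub>F s in net. \<forall>x\<in>X. dist (G s x) (F x) < e"
    by eventually_elim (meson order.strict_trans1)
qed

section \<open>Exponentials cut off to balls\<close>

lemma norm_exp_minus_one_le: "cmod (exp w - 1) \<le> cmod w * exp (cmod w)"
proof -
  have "cmod (exp w - 1) \<le> exp \<bar>Re w\<bar> * cmod w" using Taylor_exp[of w 0] by simp
  also have "\<dots> \<le> exp (cmod w) * cmod w" by (intro mult_right_mono) (simp_all add: abs_Re_le_cmod)
  finally show ?thesis by (simp add: mult.commute)
qed

lemma norm_exp_minus_linear_le: "cmod (exp w - 1 - w) \<le> (cmod w)\<^sup>2 * exp (cmod w)"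
proof -
  have "cmod (exp w - 1 - w) \<le> exp \<bar>Re w\<bar> * (cmod w)\<^sup>2"
    using Taylor_exp[of w 1] by (simp add: algebra_simps power2_eq_square)
  also have "\<dots> \<le> exp (cmod w) * (cmod w)\<^sup>2" by (intro mult_right_mono) (simp_all add: abs_Re_le_cmod)
  finally show ?thesis by (simp add: mult.commute)
qed

text \<open>Written as a product so that multiplicativity turns truncation into composition with
  \<open>E (cball 0 (real n))\<close>.\<close>

definition cutoff :: "nat \<Rightarrow> (complex \<Rightarrow> complex) \<Rightarrow> complex \<Rightarrow> complex"
  where "cutoff n F z = indicator (cball 0 (real n)) z * F z"

lemma bounded_borel_cutoff:
  assumes "continuous_on UNIV F"
  shows "bounded_borel (cutoff n F)"
proof -
  have "compact (F ` cball 0 (real n))"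
    using assms by (intro compact_continuous_image) (auto intro: continuous_on_subset)
  then have "bounded (F ` cball 0 (real n))" by (rule compact_imp_bounded)
  then obtain K where "\<And>z. z \<in> cball 0 (real n) \<Longrightarrow> cmod (F z) \<le> K"
    unfolding bounded_iff by blast
  then have "cmod (cutoff n F z) \<le> max K 0" for z
    unfolding cutoff_def by (cases "z \<in> cball 0 (real n)") (simp_all add: le_max_iff_disj del: mem_cball mem_cball_0)
  moreover have "cutoff n F \<in> borel_measurable borel"
    unfolding cutoff_def[abs_def] using assms
    by (intro borel_measurable_times borel_measurable_indicator borel_measurable_continuous_onI) auto
  ultimately show ?thesis by (blast intro: bounded_borelI)
qed

lemma uniform_limit_cutoff_exp:
  "uniform_limit UNIV (\<lambda>s::real. cutoff m (\<lambda>z. exp (- of_real s * z))) (cutoff m (\<lambda>z. exp (- of_real r * z))) (at r within S)"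
proof (rule uniform_limit_bound)
  let ?k = "\<lambda>s. exp (\<bar>r\<bar> * m) * ((\<bar>s - r\<bar> * m) * exp (\<bar>s - r\<bar> * m))"
  have "dist (cutoff m (\<lambda>z. exp (- of_real s * z)) z) (cutoff m (\<lambda>z. exp (- of_real r * z)) z) \<le> ?k s" for s z
  proof (cases "cmod z \<le> m")
    case True
    \<comment> \<open>Factoring out the exponential at time \<open>r\<close> leaves a factor
      governed by \<open>s - r\<close>; the cut-off bounds both uniformly through
      \<open>cmod z \<le> m\<close>.\<close>
    have "exp (- of_real s * z) - exp (- of_real r * z) = exp (- of_real r * z) * (exp (- of_real (s - r) * z) - 1)"
      by (simp add: algebra_simps flip: exp_add)
    moreover have "cmod (exp (- of_real r * z)) \<le> exp (\<bar>r\<bar> * m)"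
    proof -
      have "Re (- of_real r * z) \<le> cmod (- of_real r * z)" by (rule complex_Re_le_cmod)
      also have "\<dots> \<le> \<bar>r\<bar> * m" using True by (simp add: norm_mult mult_left_mono)
      finally show ?thesis by (simp only: norm_exp_eq_Re exp_le_cancel_iff)
    qed
    moreover have "cmod (exp (- of_real (s - r) * z) - 1) \<le> (\<bar>s - r\<bar> * m) * exp (\<bar>s - r\<bar> * m)"
    proof -
      have "cmod (- of_real (s - r) * z) \<le> \<bar>s - r\<bar> * m"
        using True unfolding norm_mult norm_minus_cancel norm_of_real by (intro mult_left_mono) auto
      then show ?thesis
        by (intro order_trans[OF norm_exp_minus_one_le] mult_mono) auto
    qed
    ultimately show ?thesis
      using True by (simp add: cutoff_def dist_norm norm_mult mult_mono)
  qed (simp add: cutoff_def)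
  then show "\<forall>\<^sub>F s in at r within S. \<forall>z\<in>UNIV.
    dist (cutoff m (\<lambda>z. exp (- of_real s * z)) z) (cutoff m (\<lambda>z. exp (- of_real r * z)) z) \<le> ?k s"
    by (intro always_eventually) blast
  have "(?k \<longlongrightarrow> exp (\<bar>r\<bar> * m) * ((\<bar>r - r\<bar> * m) * exp (\<bar>r - r\<bar> * m))) (at r within S)"
    by (intro tendsto_intros)
  then show "(?k \<longlongrightarrow> 0) (at r within S)" by simp
qed

lemma uniform_limit_cutoff_exp_quotient:
  "uniform_limit UNIV (\<lambda>h. cutoff m (\<lambda>z. (exp (- of_real h * z) - 1) / of_real h)) (cutoff m uminus) (at_right 0)"
proof (rule uniform_limit_bound)
  let ?k = "\<lambda>h. h * (real m)\<^sup>2 * exp (h * m)"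
  have "dist (cutoff m (\<lambda>z. (exp (- of_real h * z) - 1) / of_real h) z) (cutoff m uminus z) \<le> ?k h"
    if h: "0 < h" for h z
  proof (cases "cmod z \<le> m")
    case True
    have le: "cmod (- of_real h * z) \<le> h * m" using True h by (simp add: norm_mult)
    have "cmod ((exp (- of_real h * z) - 1) / of_real h + z) =
      cmod (exp (- of_real h * z) - 1 - (- of_real h * z)) / h"
    proof -
      have "(exp (- of_real h * z) - 1) / of_real h + z = (exp (- of_real h * z) - 1 - (- of_real h * z)) / of_real h"
        using h by (simp add: field_simps)
      then show ?thesis using h by (simp add: norm_divide)
    qed
    also have "\<dots> \<le> ((h * m)\<^sup>2 * exp (h * m)) / h"
      using le h by (intro divide_right_mono order_trans[OF norm_exp_minus_linear_le] mult_mono power_mono) auto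
    also have "\<dots> = ?k h" using h by (simp add: power2_eq_square)
    finally show ?thesis using True by (simp add: cutoff_def dist_norm)
  qed (use h in \<open>simp add: cutoff_def\<close>)
  then show "\<forall>\<^sub>F h in at_right 0. \<forall>z\<in>UNIV.
    dist (cutoff m (\<lambda>z. (exp (- of_real h * z) - 1) / of_real h) z) (cutoff m uminus z) \<le> ?k h"
    by (auto simp: eventually_at_right_field intro: exI[of _ 1])
  have "(?k \<longlongrightarrow> 0 * (real m)\<^sup>2 * exp (0 * real m)) (at_right 0)"
    by (intro tendsto_intros)
  then show "(?k \<longlongrightarrow> 0) (at_right 0)" by simp
qed

section \<open>Local boundedness and strong continuity of semigroups\<close>

lemma C0_semigroupD:
  assumes "C0_semigroup T"
  shows "t \<ge> 0 \<Longrightarrow> bounded_linear (T t)" "T 0 f = f"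
    "s \<ge> 0 \<Longrightarrow> t \<ge> 0 \<Longrightarrow> T (s + t) f = T s (T t f)"
    "((\<lambda>t. T t f) \<longlongrightarrow> f) (at_right 0)"
  using assms by (auto simp: C0_semigroup_def bounded_clinear_def)

lemma C0_semigroup_right_continuous:
  assumes "C0_semigroup T" "e > 0"
  obtains d where "d > 0" "\<And>h. 0 \<le> h \<Longrightarrow> h < d \<Longrightarrow> norm (T h f - f) < e"
proof -
  obtain d where d: "d > 0" "\<And>h. 0 < h \<Longrightarrow> h < d \<Longrightarrow> dist (T h f) f < e"
    using tendstoD[OF C0_semigroupD(4)[OF assms(1), of f] assms(2)]
    by (auto simp: eventually_at_right_field)
  have "norm (T h f - f) < e" if "0 \<le> h" "h < d" for h
    using d(2)[of h] that assms(2) C0_semigroupD(2)[OF assms(1)] by (cases "h = 0") (auto simp: dist_norm)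
  then show ?thesis using that d(1) by blast
qed

text \<open>Continuity at 0 bounds each orbit only on an interval depending on the vector. A
  counterexample sequence \<open>h n\<close> tending to 0 removes this dependence: every
  \<open>T (h n) x\<close> converges to \<open>x\<close>, so uniform boundedness contradicts the
  growth of the norms.\<close>

lemma C0_semigroup_bounded_near_0:
  fixes T :: "real \<Rightarrow> 'a::cbanach \<Rightarrow> 'a"
  assumes T: "C0_semigroup T"
  obtains d M where "d > 0" "M \<ge> 0" "\<And>h f. 0 \<le> h \<Longrightarrow> h \<le> d \<Longrightarrow> norm (T h f) \<le> M * norm f"
proof -
  have "\<exists>n. \<forall>h f. 0 \<le> h \<longrightarrow> h \<le> inverse (real (Suc n)) \<longrightarrow> norm (T h f) \<le> real n * norm f"
  proof (rule ccontr)
    assume "\<not> ?thesis"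
    then obtain h g where hg: "\<And>n. 0 \<le> h n" "\<And>n. h n \<le> inverse (real (Suc n))"
      "\<And>n. real n * norm (g n) < norm (T (h n) (g n))"
      by (simp only: not_all not_ex not_le not_imp) metis
    have "h \<longlonglongrightarrow> 0"
      by (rule tendsto_sandwich[OF _ _ tendsto_const LIMSEQ_inverse_real_of_nat])
        (use hg in \<open>auto intro: always_eventually\<close>)
    have "\<exists>K. \<forall>n\<in>UNIV. norm (T (h n) x) \<le> K" for x
    proof -
      have "(\<lambda>n. T (h n) x) \<longlonglongrightarrow> x"
      proof (rule tendstoI)
        fix e :: real assume "e > 0"
        then obtain d where d: "d > 0" "\<And>h. 0 \<le> h \<Longrightarrow> h < d \<Longrightarrow> norm (T h x - x) < e"
          using C0_semigroup_right_continuous[OF T] by blast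
        from order_tendstoD(2)[OF \<open>h \<longlonglongrightarrow> 0\<close> d(1)]
        show "\<forall>\<^sub>F n in sequentially. dist (T (h n) x) x < e"
          by eventually_elim (use d(2) hg(1) in \<open>auto simp: dist_norm\<close>)
      qed
      then have "Bseq (\<lambda>n. T (h n) x)" by (intro convergent_imp_Bseq convergentI)
      then show ?thesis unfolding Bseq_def by auto
    qed
    then obtain M where M: "\<And>n x. norm (T (h n) x) \<le> M * norm x"
      using uniform_boundedness[of UNIV "\<lambda>n. T (h n)"] C0_semigroupD(1)[OF T hg(1)] by blast
    obtain n :: nat where "M \<le> real n" using real_arch_simple by blast
    then have "M * norm (g n) \<le> real n * norm (g n)" by (intro mult_right_mono) auto
    then show False using hg(3)[of n] M[of n "g n"] by linarith
  qed
  then obtain n where "\<And>h f. 0 \<le> h \<Longrightarrow> h \<le> inverse (real (Suc n)) \<Longrightarrow> norm (T h f) \<le> real n * norm f"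
    by blast
  then show ?thesis using that[of "inverse (real (Suc n))" "real n"] by simp
qed

lemma C0_semigroup_locally_bounded:
  fixes T :: "real \<Rightarrow> 'a::cbanach \<Rightarrow> 'a"
  assumes T: "C0_semigroup T"
  obtains M where "M > 0" "\<And>h f. 0 \<le> h \<Longrightarrow> h \<le> t \<Longrightarrow> norm (T h f) \<le> M * norm f"
proof -
  obtain d M where dM: "d > 0" "M \<ge> 0" "\<And>h f. 0 \<le> h \<Longrightarrow> h \<le> d \<Longrightarrow> norm (T h f) \<le> M * norm f"
    using C0_semigroup_bounded_near_0[OF T] by blast
  \<comment> \<open>With a base of at least 1, a short time \<open>h \<le> d\<close> is also covered
    by every higher power.\<close>
  let ?N = "max 1 M"
  have base: "norm (T h f) \<le> ?N * norm f" if "0 \<le> h" "h \<le> d" for h f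
    using dM(3)[OF that, of f] mult_right_mono[of M ?N "norm f"] by simp
  have bound: "norm (T h f) \<le> ?N ^ Suc k * norm f" if "0 \<le> h" "h \<le> real (Suc k) * d" for k h f
    using that
  proof (induction k arbitrary: h f)
    case 0
    then show ?case using base by simp
  next
    case (Suc k)
    have N: "1 \<le> ?N ^ Suc k" by (rule one_le_power) simp
    show ?case
    proof (cases "h \<le> d")
      case True
      then have "norm (T h f) \<le> ?N * norm f" using base Suc.prems by simp
      also have "\<dots> \<le> (?N * ?N ^ Suc k) * norm f"
        using mult_left_mono[OF N, of ?N] by (intro mult_right_mono) auto
      finally show ?thesis by simp
    next
      case False
      have "norm (T (d + (h - d)) f) \<le> ?N * norm (T (h - d) f)"
        using False dM(1) by (subst C0_semigroupD(3)[OF T]) (auto intro!: base)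
      also have "\<dots> \<le> ?N * (?N ^ Suc k * norm f)"
        using False Suc.prems by (intro mult_left_mono Suc.IH) (auto simp: algebra_simps)
      finally show ?thesis by (simp add: mult.assoc)
    qed
  qed
  obtain k :: nat where "t / d \<le> real k" using real_arch_simple by blast
  then have "t \<le> real (Suc k) * d" using dM(1) by (simp add: field_simps)
  then show ?thesis
    using that[of "?N ^ Suc k"] bound[of _ k] by (meson order_trans zero_less_power less_le_trans zero_less_one max.cobounded1)
qed

text \<open>Factoring out \<open>T\<close> at the smaller of the two times leaves
  \<open>T (b - a) f - f\<close>, controlled at 0; the local norm bound makes the estimate uniform
  in \<open>a\<close>, so it covers continuity from the left too.\<close>

lemma C0_semigroup_continuous_on:
  fixes T :: "real \<Rightarrow> 'a::cbanach \<Rightarrow> 'a"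
  assumes T: "C0_semigroup T"
  shows "continuous_on {0..t} (\<lambda>s. T s f)"
  unfolding continuous_on_iff
proof (intro ballI allI impI)
  fix s e :: real assume s: "s \<in> {0..t}" and e: "e > 0"
  obtain M where M: "M > 0" "\<And>h f. 0 \<le> h \<Longrightarrow> h \<le> t \<Longrightarrow> norm (T h f) \<le> M * norm f"
    using C0_semigroup_locally_bounded[OF T] by metis
  obtain d where d: "d > 0" "\<And>h. 0 \<le> h \<Longrightarrow> h < d \<Longrightarrow> norm (T h f - f) < e / M"
    using C0_semigroup_right_continuous[OF T, of "e / M" f] e M(1) by auto
  have le: "norm (T b f - T a f) < e" if "0 \<le> a" "a \<le> b" "b \<le> t" "b - a < d" for a b
  proof -
    have "T b f - T a f = T a (T (b - a) f - f)"
      using C0_semigroupD(3)[OF T, of a "b - a" f] that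
        linear_diff[OF bounded_linear.linear[OF C0_semigroupD(1)[OF T that(1)]]] by simp
    then have "norm (T b f - T a f) \<le> M * norm (T (b - a) f - f)" using M(2) that by simp
    also have "\<dots> < M * (e / M)" using d(2)[of "b - a"] that M(1) by (intro mult_strict_left_mono) auto
    finally show ?thesis using M(1) by simp
  qed
  have "dist (T r f) (T s f) < e" if "r \<in> {0..t}" "dist r s < d" for r
    using le[of r s] le[of s r] that s
    by (cases "r \<le> s") (auto simp: dist_norm norm_minus_commute)
  then show "\<exists>d>0. \<forall>r\<in>{0..t}. dist r s < d \<longrightarrow> dist (T r f) (T s f) < e"
    using d(1) by blast
qed

text \<open>\<open>T s\<close> commutes with \<open>T h\<close>, so it carries the difference
  quotients of \<open>f\<close> to those of \<open>T s f\<close>.\<close>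

lemma generator_domain_invariant:
  assumes T: "C0_semigroup T" and A: "has_generator T D A" and f: "f \<in> D" and s: "0 \<le> s"
  shows "T s f \<in> D"
proof -
  have lin: "bounded_linear (T s)" by (rule C0_semigroupD(1)[OF T s])
  have "((\<lambda>h. (T h f - f) /\<^sub>R h) \<longlongrightarrow> A f) (at_right 0)"
    using A f by (simp add: has_generator_def)
  then have "((\<lambda>h. T s ((T h f - f) /\<^sub>R h)) \<longlongrightarrow> T s (A f)) (at_right 0)"
    by (rule bounded_linear.tendsto[OF lin])
  moreover have "\<forall>\<^sub>F h in at_right 0. T s ((T h f - f) /\<^sub>R h) = (T h (T s f) - T s f) /\<^sub>R h"
    unfolding eventually_at_right_field
  proof (intro exI[of _ 1] conjI allI impI)
    fix h :: real assume "0 < h"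
    then have "T s (T h f) = T h (T s f)"
      using C0_semigroupD(3)[OF T, of s h f] C0_semigroupD(3)[OF T, of h s f] s by (simp add: add.commute)
    then show "T s ((T h f - f) /\<^sub>R h) = (T h (T s f) - T s f) /\<^sub>R h"
      using bounded_linear.linear[OF lin] by (simp add: linear_scale linear_diff)
  qed simp
  ultimately have "((\<lambda>h. (T h (T s f) - T s f) /\<^sub>R h) \<longlongrightarrow> T s (A f)) (at_right 0)"
    by (rule Lim_transform_eventually)
  then show ?thesis using A unfolding has_generator_def by blast
qed

section \<open>The spectrum of a spectral integral\<close>

context spectral_measure_space
begin

text \<open>This allows identities between vectors to be checked after applying the projections
  \<open>E (cball 0 (real n))\<close>, where all functions are cut off.\<close>

lemma E_cball_tendsto: "(\<lambda>n. E (cball 0 (real n)) f) \<longlonglongrightarrow> f"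
proof -
  have "(\<Union>n. cball 0 (real n)) = (UNIV :: complex set)"
    using real_arch_simple by (auto simp: set_eq_iff)
  moreover have "incseq (\<lambda>n. cball (0::complex) (real n))"
    by (intro monoI subset_cball) simp
  moreover have "range (\<lambda>n. cball (0::complex) (real n)) \<subseteq> sets borel"
    by (intro image_subsetI borel_closed closed_cball)
  ultimately show ?thesis
    using E_incseq[of "\<lambda>n. cball 0 (real n)" f] by simp
qed

lemma Phi_cutoff_E_cball:
  assumes "bounded_borel (cutoff n F)" "m \<le> n"
  shows "Phi (cutoff n F) (E (cball 0 (real m)) f) = Phi (cutoff m F) f"
proof -
  have "(\<lambda>z. cutoff n F z * indicator (cball 0 (real m)) z) = cutoff m F"
    using assms(2) by (auto simp: cutoff_def indicator_def fun_eq_iff)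
  then show ?thesis
    using Phi_mult[OF assms(1) bounded_borel_indicator, of "cball 0 (real m)" f]
    by (simp add: Phi_indicator)
qed

lemma E_cball_Phi_cutoff:
  assumes "bounded_borel (cutoff n F)" "m \<le> n"
  shows "E (cball 0 (real m)) (Phi (cutoff n F) f) = Phi (cutoff m F) f"
  using Phi_cutoff_E_cball[OF assms, of f] Phi_commute[OF assms(1) bounded_borel_indicator, of "cball 0 (real m)" f]
  by (simp add: Phi_indicator)

text \<open>The hypotheses say that \<open>B\<close> is the spectral integral of \<open>F\<close>.\<close>

lemma spectrum_eq_essential_range:
  assumes F [measurable]: "F \<in> borel_measurable borel" and cutF: "\<And>n. bounded_borel (cutoff n F)"
    and closed: "closed_operator D B"
    and dom: "\<And>n f. E (cball 0 (real n)) f \<in> D"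
    and restr: "\<And>n f. B (E (cball 0 (real n)) f) = Phi (cutoff n F) f"
    and comm: "\<And>n f. f \<in> D \<Longrightarrow> E (cball 0 (real n)) (B f) = Phi (cutoff n F) f"
  shows "spectrum D B = {\<mu>. \<forall>r>0. \<exists>f. E (F -` ball \<mu> r) f \<noteq> 0}"
proof -
  have vim [measurable]: "F -` ball \<mu> r \<in> sets borel" for \<mu> r
    using measurable_sets[OF F, of "ball \<mu> r"] by simp
  have "\<mu> \<in> resolvent_set D B" if r: "r > 0" and null: "\<And>f. E (F -` ball \<mu> r) f = 0" for \<mu> r
  proof -
    define \<delta> where "\<delta> = F -` ball \<mu> r"
    have [measurable]: "\<delta> \<in> sets borel" unfolding \<delta>_def by (rule vim)
    have full: "E (- \<delta>) f = f" for f
    proof -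
      have "E (\<delta> \<union> - \<delta>) f = E \<delta> f + E (- \<delta>) f" by (rule E_Un) auto
      then show ?thesis using null by (simp add: \<delta>_def)
    qed
    \<comment> \<open>The candidate resolvent symbol: it inverts \<open>F - \<mu>\<close> off the
      null set, where the modulus is at least \<open>r\<close>, and is 0 on it.\<close>
    define G where "G z = indicator (- \<delta>) z / (F z - \<mu>)" for z
    have G: "bounded_borel G"
    proof (rule bounded_borelI)
      show "G \<in> borel_measurable borel" unfolding G_def[abs_def] by measurable
      show "cmod (G z) \<le> 1 / r" for z
        using r by (cases "z \<in> \<delta>")
          (auto simp: G_def \<delta>_def norm_divide dist_norm norm_minus_commute intro!: divide_left_mono mult_pos_pos)
    qed
    have Gmult: "G z * (F z - \<mu>) = indicator (- \<delta>) z" for z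
      using r by (auto simp: G_def \<delta>_def indicator_def)
    have left: "Phi G (Phi (cutoff n F) f - \<mu> *\<^sub>C E (cball 0 (real n)) f) = E (cball 0 (real n)) f" for n f
    proof -
      have ind: "bounded_borel (\<lambda>z. \<mu> * indicator (cball 0 (real n)) z)"
        by (intro bounded_borel_mult bounded_borel_const bounded_borel_indicator) auto
      have "Phi (cutoff n F) f - \<mu> *\<^sub>C E (cball 0 (real n)) f =
        Phi (\<lambda>z. cutoff n F z - \<mu> * indicator (cball 0 (real n)) z) f"
        using cutF ind bounded_borel_indicator[of "cball 0 (real n)"]
        by (simp add: Phi_diff Phi_scaleC Phi_indicator)
      then have "Phi G (Phi (cutoff n F) f - \<mu> *\<^sub>C E (cball 0 (real n)) f) =
        Phi (\<lambda>z. G z * (cutoff n F z - \<mu> * indicator (cball 0 (real n)) z)) f"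
        using G bounded_borel_diff[OF cutF ind] by (simp add: Phi_mult)
      also have "(\<lambda>z. G z * (cutoff n F z - \<mu> * indicator (cball 0 (real n)) z)) = indicator (cball 0 (real n) \<inter> - \<delta>)"
      proof
        fix z
        have "G z * (cutoff n F z - \<mu> * indicator (cball 0 (real n)) z) = indicator (cball 0 (real n)) z * (G z * (F z - \<mu>))"
          by (simp add: cutoff_def algebra_simps)
        then show "G z * (cutoff n F z - \<mu> * indicator (cball 0 (real n)) z) = indicator (cball 0 (real n) \<inter> - \<delta>) z"
          by (simp only: Gmult indicator_inter_arith)
      qed
      also have "Phi \<dots> f = E (cball 0 (real n)) f"
        by (simp add: Phi_indicator E_Int full)
      finally show ?thesis .
    qed
    show ?thesis
      unfolding resolvent_set_def
    proof (intro CollectI exI[of _ "Phi G"] conjI allI ballI)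
      show "bounded_clinear (Phi G)"
        by (simp add: bounded_clinear_def bounded_linear_Phi G Phi_scaleC)
      fix g
      have "E (cball 0 (real n)) (g + \<mu> *\<^sub>C Phi G g) = B (E (cball 0 (real n)) (Phi G g))" for n
      proof -
        have "E (cball 0 (real n)) g = Phi G (Phi (cutoff n F) g) - \<mu> *\<^sub>C Phi G (E (cball 0 (real n)) g)"
          using left[of n g] by (simp add: Phi_linear_simps G Phi_scaleC)
        also have "Phi G (Phi (cutoff n F) g) = Phi (cutoff n F) (Phi G g)"
          by (rule Phi_commute[OF G cutF])
        also have "Phi G (E (cball 0 (real n)) g) = E (cball 0 (real n)) (Phi G g)"
          using Phi_commute[OF G bounded_borel_indicator, of "cball 0 (real n)" g] by (simp add: Phi_indicator)
        finally show ?thesis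
          by (simp add: restr E_scaleC linear_add[OF bounded_linear.linear[OF bounded_linear_E]])
      qed
      \<comment> \<open>The truncations of \<open>Phi G g\<close> lie in the domain and their images
        converge, so closedness of \<open>B\<close> brings \<open>Phi G g\<close> itself into the
        domain.\<close>
      then have "(\<lambda>n. B (E (cball 0 (real n)) (Phi G g))) \<longlonglongrightarrow> g + \<mu> *\<^sub>C Phi G g"
        using E_cball_tendsto[of "g + \<mu> *\<^sub>C Phi G g"] by simp
      from closed_operatorD[OF closed dom E_cball_tendsto this]
      show "Phi G g \<in> D" "B (Phi G g) - \<mu> *\<^sub>C Phi G g = g" by auto
    next
      fix f assume f: "f \<in> D"
      have "E (cball 0 (real n)) (Phi G (B f - \<mu> *\<^sub>C f)) = E (cball 0 (real n)) f" for n
      proof -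
        have "E (cball 0 (real n)) (Phi G (B f - \<mu> *\<^sub>C f)) = Phi G (E (cball 0 (real n)) (B f - \<mu> *\<^sub>C f))"
          using Phi_commute[OF G bounded_borel_indicator, of "cball 0 (real n)"] by (simp add: Phi_indicator)
        also have "E (cball 0 (real n)) (B f - \<mu> *\<^sub>C f) = Phi (cutoff n F) f - \<mu> *\<^sub>C E (cball 0 (real n)) f"
          by (simp add: comm[OF f] E_scaleC linear_diff[OF bounded_linear.linear[OF bounded_linear_E]])
        finally show ?thesis by (simp add: left)
      qed
      then show "Phi G (B f - \<mu> *\<^sub>C f) = f"
        using E_cball_tendsto[of "Phi G (B f - \<mu> *\<^sub>C f)"] E_cball_tendsto[of f] LIMSEQ_unique by simp
    qed
  qed
  moreover have False if \<mu>: "\<mu> \<in> resolvent_set D B" and nonnull: "\<And>r. r > 0 \<Longrightarrow> \<exists>f. E (F -` ball \<mu> r) f \<noteq> 0" for \<mu>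
  proof -
    obtain R where R: "bounded_linear R" "\<And>f. f \<in> D \<Longrightarrow> R (B f - \<mu> *\<^sub>C f) = f"
      using \<mu> unfolding resolvent_set_def bounded_clinear_def by blast
    obtain K where K: "K > 0" "\<And>x. norm (R x) \<le> norm x * K"
      using bounded_linear.pos_bounded[OF R(1)] by blast
    \<comment> \<open>Chosen so that \<open>opbound * r * K < 1\<close>: a nonzero approximate
      eigenvector with error \<open>opbound * r\<close> then contradicts the bound \<open>K\<close>
      on the resolvent. The summand 1 allows for \<open>opbound = 0\<close>.\<close>
    define r where "r = 1 / (2 * K * (opbound + 1))"
    have r: "r > 0" using K(1) opbound_nonneg by (simp add: r_def)
    define \<delta> where "\<delta> = F -` ball \<mu> r"
    have [measurable]: "\<delta> \<in> sets borel" unfolding \<delta>_def by (rule vim)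
    obtain f where f: "E \<delta> f \<noteq> 0" using nonnull[OF r] by (auto simp: \<delta>_def)
    \<comment> \<open>The approximate eigenvector must be truncated as well, to lie in
      \<open>D\<close> and have a computable image; a large enough ball keeps it nonzero.\<close>
    have "\<exists>n. E (cball 0 (real n)) (E \<delta> f) \<noteq> 0"
    proof (rule ccontr)
      assume "\<not> ?thesis"
      then show False using E_cball_tendsto[of "E \<delta> f"] f by (simp add: LIMSEQ_const_iff)
    qed
    then obtain n where n: "E (cball 0 (real n)) (E \<delta> f) \<noteq> 0" by blast
    define g where "g = E (cball 0 (real n)) (E \<delta> f)"
    have gn: "E (cball 0 (real n)) g = g"
      unfolding g_def by (simp flip: E_Int)
    have "E \<delta> g = g"
      unfolding g_def by (simp add: Int_ac flip: E_Int)
    have ind: "bounded_borel (\<lambda>z. \<mu> * indicator (cball 0 (real n)) z)"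
      by (intro bounded_borel_mult bounded_borel_const bounded_borel_indicator) auto
    have Bg: "B g - \<mu> *\<^sub>C g = Phi (\<lambda>z. cutoff n F z - \<mu> * indicator (cball 0 (real n)) z) g"
      using cutF ind bounded_borel_indicator[of "cball 0 (real n)"] restr[of n g]
      by (simp add: Phi_diff Phi_scaleC Phi_indicator gn)
    also have "\<dots> = Phi (\<lambda>z. (cutoff n F z - \<mu> * indicator (cball 0 (real n)) z) * indicator \<delta> z) g"
      using \<open>E \<delta> g = g\<close> by (simp add: Phi_mult bounded_borel_diff cutF ind bounded_borel_indicator Phi_indicator)
    also have "norm \<dots> \<le> opbound * r * norm g"
    proof (rule Phi_norm_le)
      show "bounded_borel (\<lambda>z. (cutoff n F z - \<mu> * indicator (cball 0 (real n)) z) * indicator \<delta> z)"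
        by (intro bounded_borel_mult bounded_borel_diff cutF ind bounded_borel_indicator) auto
      show "cmod ((cutoff n F z - \<mu> * indicator (cball 0 (real n)) z) * indicator \<delta> z) \<le> r" for z
        using r by (auto simp: cutoff_def \<delta>_def indicator_def dist_norm norm_minus_commute)
    qed
    finally have "norm (B g - \<mu> *\<^sub>C g) \<le> opbound * r * norm g" .
    moreover have "g \<in> D" using dom[of n g] gn by simp
    ultimately have "norm (R (B g - \<mu> *\<^sub>C g)) \<le> (opbound * r * norm g) * K"
      using K(1) by (intro order_trans[OF K(2)] mult_right_mono) auto
    then have "norm g \<le> (opbound * r * norm g) * K" using R(2) \<open>g \<in> D\<close> by simp
    moreover have "opbound * r * K < 1"
    proof -
      have "opbound * r * K = opbound / (2 * (opbound + 1))" using K(1) by (simp add: r_def)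
      also have "\<dots> < 1" using opbound_nonneg by (simp add: divide_less_eq)
      finally show ?thesis .
    qed
    moreover have "norm g > 0" using n by (simp add: g_def)
    ultimately show False
      using mult_strict_right_mono[of "opbound * r * K" 1 "norm g"] by (simp add: mult_ac)
  qed
  ultimately show ?thesis unfolding spectrum_def by (intro set_eqI) blast
qed

end

section \<open>Semigroups generated by scalar type spectral operators\<close>

context spectral_measure_space
begin

lemma truncated_integral_eq: "truncated_integral E n = Phi (cutoff n (\<lambda>z. z))"
proof -
  have "(\<lambda>z. if cmod z \<le> real n then z else 0) = cutoff n (\<lambda>z. z)"
    by (auto simp: cutoff_def indicator_def fun_eq_iff)
  then show ?thesis
    by (simp add: truncated_integral_def spectral_integral_eq_Phi bounded_borel_cutoff)
qed

text \<open>On the range of \<open>E (cball 0 (real m))\<close> the truncated integrals stop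
  changing once \<open>n \<ge> m\<close>.\<close>

lemma resolution_restrict:
  assumes A: "resolution_of_identity E D A"
  shows "E (cball 0 (real m)) f \<in> D" "A (E (cball 0 (real m)) f) = Phi (cutoff m (\<lambda>z. z)) f"
proof -
  have "\<forall>\<^sub>F n in sequentially. truncated_integral E n (E (cball 0 (real m)) f) = Phi (cutoff m (\<lambda>z. z)) f"
    using eventually_ge_at_top[of m]
    by eventually_elim (simp add: truncated_integral_eq Phi_cutoff_E_cball bounded_borel_cutoff)
  then have lim: "(\<lambda>n. truncated_integral E n (E (cball 0 (real m)) f)) \<longlonglongrightarrow> Phi (cutoff m (\<lambda>z. z)) f"
    by (rule tendsto_eventually)
  then show D: "E (cball 0 (real m)) f \<in> D"
    using A unfolding resolution_of_identity_def convergent_def by blast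
  have "(\<lambda>n. truncated_integral E n (E (cball 0 (real m)) f)) \<longlonglongrightarrow> A (E (cball 0 (real m)) f)"
    using A D unfolding resolution_of_identity_def by blast
  then show "A (E (cball 0 (real m)) f) = Phi (cutoff m (\<lambda>z. z)) f"
    using lim by (rule LIMSEQ_unique)
qed

lemma resolution_commute:
  assumes A: "resolution_of_identity E D A" and f: "f \<in> D"
  shows "E (cball 0 (real m)) (A f) = Phi (cutoff m (\<lambda>z. z)) f"
proof (rule LIMSEQ_unique)
  have "(\<lambda>n. truncated_integral E n f) \<longlonglongrightarrow> A f"
    using A f unfolding resolution_of_identity_def by blast
  then show "(\<lambda>n. E (cball 0 (real m)) (truncated_integral E n f)) \<longlonglongrightarrow> E (cball 0 (real m)) (A f)"
    by (intro bounded_linear.tendsto[OF bounded_linear_E]) auto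
  have "\<forall>\<^sub>F n in sequentially. E (cball 0 (real m)) (truncated_integral E n f) = Phi (cutoff m (\<lambda>z. z)) f"
    using eventually_ge_at_top[of m]
    by eventually_elim (simp add: truncated_integral_eq E_cball_Phi_cutoff bounded_borel_cutoff)
  then show "(\<lambda>n. E (cball 0 (real m)) (truncated_integral E n f)) \<longlonglongrightarrow> Phi (cutoff m (\<lambda>z. z)) f"
    by (rule tendsto_eventually)
qed

lemma Phi_cutoff_mult:
  assumes "continuous_on UNIV F" "continuous_on UNIV G"
  shows "Phi (cutoff m F) (Phi (cutoff m G) f) = Phi (cutoff m (\<lambda>z. F z * G z)) f"
proof -
  have "(\<lambda>z. cutoff m F z * cutoff m G z) = cutoff m (\<lambda>z. F z * G z)"
    by (auto simp: cutoff_def indicator_def fun_eq_iff)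
  then show ?thesis using Phi_mult[of "cutoff m F" "cutoff m G" f] assms by (simp add: bounded_borel_cutoff)
qed

lemma Phi_cutoff_one: "Phi (cutoff m (\<lambda>z. 1)) f = E (cball 0 (real m)) f"
proof -
  have "cutoff m (\<lambda>z. 1) = indicator (cball 0 (real m))" by (auto simp: cutoff_def)
  then show ?thesis by (simp add: Phi_indicator)
qed

text \<open>On the range of \<open>E (cball 0 m)\<close> the generator is bounded, and
  \<open>s \<mapsto> Phi (cutoff m (\<lambda>z. exp (- s * z))) (T s f)\<close> has right derivative 0.\<close>

lemma E_cball_semigroup:
  assumes T: "C0_semigroup T" and gen: "has_generator T D A" and A: "resolution_of_identity E D A"
    and t: "0 \<le> t"
  shows "E (cball 0 (real m)) (T t f) = Phi (cutoff m (\<lambda>z. exp (of_real t * z))) f"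
proof -
  \<comment> \<open>The negative exponent undoes the expected action of \<open>T s\<close>. The
    cut-off makes these functions bounded for all real \<open>s\<close>, and they form a group up to
    the projection.\<close>
  define G where "G s = cutoff m (\<lambda>z. exp (- of_real s * z))" for s :: real
  have G: "bounded_borel (G s)" for s
    unfolding G_def by (intro bounded_borel_cutoff continuous_intros)
  have GG: "Phi (G s) (Phi (G h) f) = Phi (G (s + h)) f" for s h f
    unfolding G_def by (subst Phi_cutoff_mult) (auto simp: algebra_simps intro!: continuous_intros simp flip: exp_add)
  have G0: "Phi (G 0) f = E (cball 0 (real m)) f" for f
    by (simp add: G_def Phi_cutoff_one)
  \<comment> \<open>Restricted to \<open>D\<close>, where orbits are differentiable from the right;
    the general case follows because the vectors \<open>E (cball 0 (real n)) f\<close> lie in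
    \<open>D\<close> and tend to \<open>f\<close>.\<close>
  have core: "E (cball 0 (real m)) (T t f) = Phi (cutoff m (\<lambda>z. exp (of_real t * z))) f" if f: "f \<in> D" for f
  proof -
    define w where "w s = Phi (G s) (T s f)" for s :: real
    have "w t = w 0"
    proof (rule constant_if_right_derivative_zero[OF _ t])
      show "continuous_on {0..t} w"
        unfolding continuous_on_def w_def
      proof
        fix s assume "s \<in> {0..t}"
        then have "((\<lambda>s. T s f) \<longlongrightarrow> T s f) (at s within {0..t})"
          using C0_semigroup_continuous_on[OF T, of t f] by (simp add: continuous_on_def)
        then show "((\<lambda>s. Phi (G s) (T s f)) \<longlongrightarrow> Phi (G s) (T s f)) (at s within {0..t})"
          by (intro Phi_tendsto G) (simp_all only: G_def uniform_limit_cutoff_exp)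
      qed
      fix s :: real assume s: "0 \<le> s"
      define g where "g = T s f"
      have gD: "g \<in> D" unfolding g_def by (rule generator_domain_invariant[OF T gen f s])
      define Q where "Q h = cutoff m (\<lambda>z. (exp (- of_real h * z) - 1) / of_real h)" for h :: real
      \<comment> \<open>At \<open>h = 0\<close> division by zero makes the quotient 0, so the claim
        holds there too, as \<open>Phi_tendsto\<close> demands it of every \<open>h\<close>.\<close>
      have Q: "bounded_borel (Q h)" for h
        unfolding Q_def by (cases "h = 0") (auto intro!: bounded_borel_cutoff continuous_intros)
      \<comment> \<open>Product rule at \<open>s\<close>, with \<open>Phi (G s)\<close> factored
        out: one term differentiates the orbit and gives the cut-off of \<open>A g\<close>, the
        other differentiates the exponential and gives its negative.\<close>
      have "((\<lambda>h. Phi (G h) ((T h g - g) /\<^sub>R h)) \<longlongrightarrow> Phi (G 0) (A g)) (at_right 0)"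
        using gen gD unfolding has_generator_def
        by (intro Phi_tendsto G) (simp_all only: G_def uniform_limit_cutoff_exp)
      moreover have "((\<lambda>h. Phi (Q h) g) \<longlongrightarrow> Phi (cutoff m uminus) g) (at_right 0)"
        using uniform_limit_cutoff_exp_quotient[of m]
        by (intro Phi_tendsto Q tendsto_const bounded_borel_cutoff continuous_intros) (simp add: Q_def[abs_def])
      ultimately have "((\<lambda>h. Phi (G s) (Phi (G h) ((T h g - g) /\<^sub>R h) + Phi (Q h) g)) \<longlongrightarrow>
        Phi (G s) (Phi (G 0) (A g) + Phi (cutoff m uminus) g)) (at_right 0)"
        by (intro bounded_linear.tendsto[OF bounded_linear_Phi[OF G]] tendsto_add)
      moreover have "Phi (G 0) (A g) + Phi (cutoff m uminus) g = 0"
      proof -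
        have "(\<lambda>z. (-1) * cutoff m (\<lambda>z. z) z) = cutoff m uminus" by (auto simp: cutoff_def)
        then have "Phi (cutoff m uminus) g = - Phi (cutoff m (\<lambda>z. z)) g"
          using Phi_scaleC(2)[OF bounded_borel_cutoff[OF continuous_on_id], of "-1" m g] by (simp add: scaleC_minus_one)
        then show ?thesis by (simp add: G0 resolution_commute[OF A gD])
      qed
      moreover have "\<forall>\<^sub>F h in at_right 0. Phi (G s) (Phi (G h) ((T h g - g) /\<^sub>R h) + Phi (Q h) g) = (w (s + h) - w s) /\<^sub>R h"
        unfolding eventually_at_right_field
      proof (intro exI[of _ 1] conjI allI impI)
        fix h :: real assume h: "0 < h"
        have Th: "T (s + h) f = T h g"
          using C0_semigroupD(3)[OF T, of h s f] s h by (simp add: g_def add.commute)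
        have "Q h = (\<lambda>z. (1 / of_real h) * (G h z - G 0 z))"
          by (auto simp: Q_def G_def cutoff_def fun_eq_iff field_simps)
        then have Qh: "Phi (Q h) g = (Phi (G h) g - Phi (G 0) g) /\<^sub>R h"
          using G by (simp add: Phi_scaleC Phi_diff bounded_borel_diff scaleR_scaleC divide_inverse)
        have "Phi (G h) ((T h g - g) /\<^sub>R h) + Phi (Q h) g = (Phi (G h) (T h g) - Phi (G 0) g) /\<^sub>R h"
          unfolding Qh linear_scale[OF bounded_linear.linear[OF bounded_linear_Phi[OF G]]]
          by (simp add: Phi_linear_simps G algebra_simps)
        then show "Phi (G s) (Phi (G h) ((T h g - g) /\<^sub>R h) + Phi (Q h) g) = (w (s + h) - w s) /\<^sub>R h"
          by (simp add: linear_scale[OF bounded_linear.linear[OF bounded_linear_Phi[OF G]]] Phi_linear_simps G GG w_def Th flip: g_def)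
      qed simp
      ultimately show "((\<lambda>h. (w (s + h) - w s) /\<^sub>R h) \<longlongrightarrow> 0) (at_right 0)"
        using linear_0[OF bounded_linear.linear[OF bounded_linear_Phi[OF G]]]
        by (auto intro: Lim_transform_eventually)
    qed
    \<comment> \<open>Constancy of \<open>w\<close> is solved for \<open>T t f\<close> by applying
      the inverse exponential on the range of the projection.\<close>
    then have "Phi (G (- t)) (Phi (G t) (T t f)) = Phi (G (- t)) (Phi (G 0) f)"
      by (simp add: w_def C0_semigroupD(2)[OF T])
    then show ?thesis
      unfolding GG by (simp add: G0) (simp add: G_def)
  qed
  have lin: "bounded_linear (\<lambda>f. E (cball 0 (real m)) (T t f))"
    using bounded_linear_compose[OF bounded_linear_E C0_semigroupD(1)[OF T t]] by simp
  show ?thesis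
  proof (rule LIMSEQ_unique)
    show "(\<lambda>n. E (cball 0 (real m)) (T t (E (cball 0 (real n)) f))) \<longlonglongrightarrow> E (cball 0 (real m)) (T t f)"
      by (rule bounded_linear.tendsto[OF lin E_cball_tendsto])
    have "bounded_borel (cutoff m (\<lambda>z. exp (of_real t * z)))"
      by (intro bounded_borel_cutoff continuous_intros)
    then show "(\<lambda>n. E (cball 0 (real m)) (T t (E (cball 0 (real n)) f))) \<longlonglongrightarrow> Phi (cutoff m (\<lambda>z. exp (of_real t * z))) f"
      unfolding core[OF resolution_restrict(1)[OF A]]
      by (rule bounded_linear.tendsto[OF bounded_linear_Phi E_cball_tendsto])
  qed
qed

text \<open>With the preceding lemma this is commutation of \<open>T t\<close> with the projections.
  It follows by projecting \<open>T t (E (cball 0 (real n)) f)\<close> to larger and larger balls: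
  from radius \<open>n\<close> on, the result no longer changes.\<close>

lemma semigroup_E_cball:
  assumes T: "C0_semigroup T" and gen: "has_generator T D A" and A: "resolution_of_identity E D A"
    and t: "0 \<le> t"
  shows "T t (E (cball 0 (real n)) f) = Phi (cutoff n (\<lambda>z. exp (of_real t * z))) f"
proof (rule LIMSEQ_unique)
  show "(\<lambda>k. E (cball 0 (real k)) (T t (E (cball 0 (real n)) f))) \<longlonglongrightarrow> T t (E (cball 0 (real n)) f)"
    by (rule E_cball_tendsto)
  have bb: "bounded_borel (cutoff k (\<lambda>z. exp (of_real t * z)))" for k
    by (intro bounded_borel_cutoff continuous_intros)
  have "\<forall>\<^sub>F k in sequentially. E (cball 0 (real k)) (T t (E (cball 0 (real n)) f)) = Phi (cutoff n (\<lambda>z. exp (of_real t * z))) f"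
    using eventually_ge_at_top[of n]
    by eventually_elim (simp add: E_cball_semigroup[OF T gen A t] Phi_cutoff_E_cball bb)
  then show "(\<lambda>k. E (cball 0 (real k)) (T t (E (cball 0 (real n)) f))) \<longlonglongrightarrow> Phi (cutoff n (\<lambda>z. exp (of_real t * z))) f"
    by (rule tendsto_eventually)
qed

text \<open>The null balls around the points of \<delta> may be uncountably many, while
  \<sigma>-additivity handles countable unions; the Lindelof property closes the gap.\<close>

lemma E_null_outside_support:
  assumes "\<delta> \<in> sets borel" "\<And>z. z \<in> \<delta> \<Longrightarrow> \<exists>r>0. \<forall>f. E (ball z r) f = 0"
  shows "E \<delta> f = 0"
proof -
  define \<F> where "\<F> = {U. open U \<and> (\<forall>f. E U f = 0)}"
  obtain \<F>' where \<F>': "\<F>' \<subseteq> \<F>" "countable \<F>'" "\<Union>\<F>' = \<Union>\<F>"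
    using Lindelof[of \<F>] by (auto simp: \<F>_def)
  \<comment> \<open>The empty set is inserted so that the family can be enumerated even if it is
    empty.\<close>
  define U where "U = from_nat_into (insert {} \<F>')"
  have U: "range U = insert {} \<F>'"
    unfolding U_def using \<F>'(2) by (intro range_from_nat_into) auto
  have U\<F>: "U n \<in> \<F>" for n
  proof -
    have "U n \<in> insert {} \<F>'" using U by blast
    moreover have "{} \<in> \<F>" by (simp add: \<F>_def)
    ultimately show ?thesis using \<F>'(1) by (metis insertE subsetD)
  qed
  have "E (\<Union>n. U n) f = 0"
    by (rule E_UN_null) (use U\<F> in \<open>simp_all add: \<F>_def image_subset_iff\<close>)
  moreover have "\<delta> \<subseteq> (\<Union>n. U n)"
  proof
    fix z assume "z \<in> \<delta>"
    then obtain r where "r > 0" "\<forall>f. E (ball z r) f = 0" using assms(2) by blast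
    then have "z \<in> ball z r" "ball z r \<in> \<F>" by (auto simp: \<F>_def)
    then have "z \<in> \<Union>\<F>'" unfolding \<F>'(3) by blast
    then show "z \<in> (\<Union>n. U n)" unfolding U by auto
  qed
  moreover have "(\<Union>n. U n) \<in> sets borel"
    using U\<F> by (intro borel_open open_UN) (simp add: \<F>_def)
  ultimately show ?thesis using E_subset_null[OF assms(1)] by blast
qed

end

theorem theorem5p1:
  fixes T :: "real \<Rightarrow> 'a::cbanach \<Rightarrow> 'a"
    and D :: "'a set" and A :: "'a \<Rightarrow> 'a" and t :: real
  assumes "C0_semigroup T"
    and "has_generator T D A"
    and "scalar_type_spectral D A"
    and "t \<ge> 0"
  shows "spectrum UNIV (T t) =
    closure ((\<lambda>z. exp (complex_of_real t * z)) ` spectrum D A)"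
proof -
  obtain E where E: "resolution_of_identity E D A" and closed: "closed_operator D A"
    using assms(3) unfolding scalar_type_spectral_def by blast
  interpret spectral_measure_space E
    using E by unfold_locales (simp add: resolution_of_identity_def)
  define F where "F z = exp (complex_of_real t * z)" for z
  have cF: "continuous_on UNIV F" unfolding F_def by (intro continuous_intros)
  have specA: "spectrum D A = {\<mu>. \<forall>r>0. \<exists>f. E (ball \<mu> r) f \<noteq> 0}"
    using spectrum_eq_essential_range[of "\<lambda>z. z" D A] closed resolution_restrict[OF E]
      resolution_commute[OF E] by (simp add: bounded_borel_cutoff)
  have specT: "spectrum UNIV (T t) = {\<mu>. \<forall>r>0. \<exists>f. E (F -` ball \<mu> r) f \<noteq> 0}"
  proof (rule spectrum_eq_essential_range)
    have "closed {p. snd p = T t (fst p)}"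
      by (intro closed_Collect_eq bounded_linear.continuous_on[OF C0_semigroupD(1)[OF assms(1,4)]]
          continuous_on_fst continuous_on_snd continuous_on_id)
    moreover have "{p. snd p = T t (fst p)} = range (\<lambda>f. (f, T t f))" by (auto simp: image_iff)
    ultimately show "closed_operator UNIV (T t)" by (simp add: closed_operator_def)
  qed (use E_cball_semigroup[OF assms(1,2) E assms(4)] semigroup_E_cball[OF assms(1,2) E assms(4)] cF
      in \<open>simp_all add: bounded_borel_cutoff borel_measurable_continuous_onI F_def[abs_def]\<close>)
  show ?thesis
    unfolding F_def[symmetric, abs_def]
  proof (rule set_eqI, rule iffI)
    fix \<mu> assume \<mu>: "\<mu> \<in> spectrum UNIV (T t)"
    show "\<mu> \<in> closure (F ` spectrum D A)"
      unfolding closure_approachable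
    proof (rule allI, rule impI, rule ccontr)
      fix e :: real assume e: "e > 0" and far: "\<not> (\<exists>y\<in>F ` spectrum D A. dist y \<mu> < e)"
      \<comment> \<open>A ball missing the image of the spectrum of \<open>A\<close> pulls back to a
        set disjoint from the support of \<open>E\<close>.\<close>
      have "E (F -` ball \<mu> e) f = 0" for f
      proof (rule E_null_outside_support)
        show "F -` ball \<mu> e \<in> sets borel"
          using measurable_sets[OF borel_measurable_continuous_onI[OF cF], of "ball \<mu> e"] by simp
        fix z assume "z \<in> F -` ball \<mu> e"
        then have "z \<notin> spectrum D A" using far by (auto simp: dist_commute)
        then show "\<exists>r>0. \<forall>f. E (ball z r) f = 0" by (auto simp: specA)
      qed
      then show False using \<mu> e by (auto simp: specT)
    qed
  next
    fix \<mu> assume \<mu>: "\<mu> \<in> closure (F ` spectrum D A)"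
    have "\<exists>f. E (F -` ball \<mu> r) f \<noteq> 0" if r: "r > 0" for r
    proof -
      obtain z where z: "z \<in> spectrum D A" "dist (F z) \<mu> < r"
        using \<mu> r by (auto simp: closure_approachable)
      \<comment> \<open>By continuity the preimage contains a ball around a support point
        \<open>z\<close>, which is not null, and a subset of a null set would be.\<close>
      have op: "open (F -` ball \<mu> r)" by (intro open_vimage open_ball cF)
      then obtain d where d: "d > 0" "ball z d \<subseteq> F -` ball \<mu> r"
        using z(2) openE[of "F -` ball \<mu> r" z] by (auto simp: dist_commute)
      obtain f where "E (ball z d) f \<noteq> 0" using z(1) d(1) by (auto simp: specA)
      then have "E (F -` ball \<mu> r) f \<noteq> 0"
        using E_subset_null[OF _ _ d(2), of f] op by auto
      then show ?thesis ..
    qed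
    then show "\<mu> \<in> spectrum UNIV (T t)" by (simp add: specT)
  qed
qed

end
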